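(* Any instance of minimum latency vertex cover (MLVC) can be reduced in polynomial time to an instance of graphic matroid MLOP.
   Context: MLVC: given a graph $G$ (and, in decision form, an integer), minimize $\sum_{(u,v)\in E(G)}\max\{\pi(u),\pi(v)\}$ over bijections $\pi:V(G)\to\{1,\dots,|V(G)|\}$. Graphic matroid MLOP: given a graph $H$, minimize $\sum_{i=1}^{|E(H)|} r(\{e:\sigma(e)\le i\})$ over bijections $\sigma:E(H)\to\{1,\dots,|E(H)|\}$, where $r(A)$ is the size of a largest acyclic subset of $A\subseteq E(H)$. *)

theory Defs
  imports "HOL-Computational_Algebra.Polynomial"
begin

section \<open>Multi-tape Turing machines and polynomial time\<close>

text \<open>
  Tapes are infinite in both directions.  Symbols are natural numbers, \<open>0\<close> being the blank.
  The states with a transition are \<open>0, \<dots>, nstates - 1\<close>, where \<open>0\<close> is the start state, and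
  \<open>nstates\<close> is the halting state.  Only the finitely many values of \<open>delta\<close> on these states and
  on lists of \<open>ntapes\<close> symbols below \<open>nsymbols\<close> matter.
\<close>

datatype move = Move_Left | Stay | Move_Right

fun offset :: "move \<Rightarrow> int" where
  "offset Move_Left = -1"
| "offset Stay = 0"
| "offset Move_Right = 1"

record tm =
  ntapes :: nat
  nstates :: nat
  nsymbols :: nat
  delta :: "nat \<Rightarrow> nat list \<Rightarrow> nat \<times> (nat \<times> move) list"

definition turing_machine :: "tm \<Rightarrow> bool" where
  "turing_machine M \<longleftrightarrow>
     ntapes M \<ge> 1 \<and> nsymbols M \<ge> 3 \<and>
     (\<forall>q ss. q < nstates M \<and> length ss = ntapes M \<and> set ss \<subseteq> {..<nsymbols M} \<longrightarrow>
        fst (delta M q ss) \<le> nstates M \<and>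
        length (snd (delta M q ss)) = ntapes M \<and>
        fst ` set (snd (delta M q ss)) \<subseteq> {..<nsymbols M})"

text \<open>A configuration is a state together with the contents and head position of each tape.\<close>

type_synonym config = "nat \<times> ((int \<Rightarrow> nat) \<times> int) list"

definition step :: "tm \<Rightarrow> config \<Rightarrow> config" where
  "step M c =
     (let (q, ts) = c in
      if q < nstates M then
        let (q', acts) = delta M q (map (\<lambda>(t, h). t h) ts)
        in (q', map2 (\<lambda>(t, h) (a, d). (t(h := a), h + offset d)) ts acts)
      else c)"

definition word_tape :: "bool list \<Rightarrow> int \<Rightarrow> nat" where
  "word_tape w i =
     (if 0 \<le> i \<and> i < int (length w) then (if w ! nat i then 2 else 1) else 0)"

definition start_config :: "tm \<Rightarrow> bool list \<Rightarrow> config" where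
  "start_config M w =
     (0, (word_tape w, 0) # replicate (ntapes M - 1) (\<lambda>_. 0, 0))"

text \<open>The input is given on the first tape, the output is left on the last one.\<close>

definition computes_within :: "tm \<Rightarrow> bool list \<Rightarrow> bool list \<Rightarrow> nat \<Rightarrow> bool" where
  "computes_within M w v T \<longleftrightarrow>
     (\<exists>t\<le>T. let (q, ts) = (step M ^^ t) (start_config M w)
             in q = nstates M \<and> fst (last ts) = word_tape v)"

definition poly_time_computable ::
  "'a set \<Rightarrow> ('a \<Rightarrow> bool list) \<Rightarrow> ('b \<Rightarrow> bool list) \<Rightarrow> ('a \<Rightarrow> 'b) \<Rightarrow> bool" where
  "poly_time_computable X enc_in enc_out f \<longleftrightarrow>
     (\<exists>M (p :: nat poly). turing_machine M \<and>
        (\<forall>x\<in>X. computes_within M (enc_in x) (enc_out (f x)) (poly p (length (enc_in x)))))"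


section \<open>The two ordering problems\<close>

definition simple_graph :: "'a set \<Rightarrow> 'a set set \<Rightarrow> bool" where
  "simple_graph V E \<longleftrightarrow> finite V \<and> (\<forall>e\<in>E. e \<subseteq> V \<and> card e = 2)"

definition mlvc_cost :: "'a set set \<Rightarrow> ('a \<Rightarrow> nat) \<Rightarrow> nat" where
  "mlvc_cost E \<pi> = (\<Sum>e\<in>E. Max (\<pi> ` e))"

definition is_cycle :: "'a set set \<Rightarrow> 'a list \<Rightarrow> bool" where
  "is_cycle A vs \<longleftrightarrow> length vs \<ge> 3 \<and> distinct vs \<and>
     (\<forall>i<length vs. {vs ! i, vs ! (Suc i mod length vs)} \<in> A)"

definition acyclic_edges :: "'a set set \<Rightarrow> bool" where
  "acyclic_edges A \<longleftrightarrow> (\<nexists>vs. is_cycle A vs)"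

definition graphic_rank :: "'a set set \<Rightarrow> nat" where
  "graphic_rank A = Max (card ` {F. F \<subseteq> A \<and> acyclic_edges F})"

definition mlop_cost :: "'a set set \<Rightarrow> ('a set \<Rightarrow> nat) \<Rightarrow> nat" where
  "mlop_cost E \<sigma> = (\<Sum>i=1..card E. graphic_rank {e \<in> E. \<sigma> e \<le> i})"

text \<open>
  An instance of the decision version of either problem consists of a graph with vertex set
  \<open>{..<n}\<close>, given by \<open>n\<close> and its edge set, and an integer threshold.
\<close>

type_synonym graph_instance = "nat \<times> nat set set \<times> int"

definition instances :: "graph_instance set" where
  "instances = {(n, E, k). simple_graph {..<n} E}"

definition MLVC :: "graph_instance set" where
  "MLVC = {(n, E, k) \<in> instances.
     \<exists>\<pi>. bij_betw \<pi> {..<n} {1..n} \<and> int (mlvc_cost E \<pi>) \<le> k}"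

definition Graphic_MLOP :: "graph_instance set" where
  "Graphic_MLOP = {(n, E, k) \<in> instances.
     \<exists>\<sigma>. bij_betw \<sigma> E {1..card E} \<and> int (mlop_cost E \<sigma>) \<le> k}"


section \<open>Binary encoding of instances\<close>

text \<open>Least significant bit first, without leading zeros.\<close>

fun nat_bits :: "nat \<Rightarrow> bool list" where
  "nat_bits n = (if n = 0 then [] else odd n # nat_bits (n div 2))"

declare nat_bits.simps [simp del]

definition int_bits :: "int \<Rightarrow> bool list" where
  "int_bits k = (k < 0) # nat_bits (nat \<bar>k\<bar>)"

definition adjacency_bits :: "nat \<Rightarrow> nat set set \<Rightarrow> bool list" where
  "adjacency_bits n E = concat (map (\<lambda>i. map (\<lambda>j. {i, j} \<in> E) [0..<n]) [0..<n])"

text \<open>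
  The number of vertices in unary, terminated by a zero, then the adjacency matrix row by row,
  then the threshold in binary.  As the matrix has \<open>n\<^sup>2\<close> entries, the unary prefix does not
  affect what is polynomial in the length of the encoding.
\<close>

definition encode :: "graph_instance \<Rightarrow> bool list" where
  "encode = (\<lambda>(n, E, k). replicate n True @ False # adjacency_bits n E @ int_bits k)"

lemma nat_bits_inject: "nat_bits m = nat_bits n \<Longrightarrow> m = n"
proof (induction m arbitrary: n rule: nat_bits.induct)
  case (1 m)
  show ?case
  proof (cases "m = 0 \<or> n = 0")
    case True
    with "1.prems" show ?thesis
      by (auto simp: nat_bits.simps[of m] nat_bits.simps[of n] split: if_splits)
  next
    case False
    with "1.prems" have *: "odd m = odd n" "nat_bits (m div 2) = nat_bits (n div 2)"
      by (auto simp: nat_bits.simps[of m] nat_bits.simps[of n])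
    with "1.IH" False have "m div 2 = n div 2" by blast
    with *(1) show ?thesis
      by (metis bit_eq_rec)
  qed
qed

lemma length_adjacency_bits: "length (adjacency_bits n E) = n * n"
  by (simp add: adjacency_bits_def length_concat comp_def sum_list_triv)

lemma inj_on_encode: "inj_on encode instances"
proof (rule inj_onI)
  fix x y
  assume xy: "x \<in> instances" "y \<in> instances" "encode x = encode y"
  obtain n E k n' E' k' where x: "x = (n, E, k)" and y: "y = (n', E', k')"
    by (metis prod_cases3)
  from xy have inst: "(n, E, k) \<in> instances" "(n', E', k') \<in> instances"
    and eq: "encode (n, E, k) = encode (n', E', k')"
    by (auto simp: x y)
  have tw: "takeWhile id (encode (m, F, l)) = replicate m True" for m F l
    by (simp add: encode_def takeWhile_append)
  have n: "n' = n"
    using arg_cong[OF eq, of "\<lambda>xs. length (takeWhile id xs)"] unfolding tw by simp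
  with eq have adj: "adjacency_bits n E = adjacency_bits n E'" and k: "int_bits k = int_bits k'"
    by (auto simp: encode_def length_adjacency_bits)
  from k have "nat \<bar>k\<bar> = nat \<bar>k'\<bar>" "k < 0 \<longleftrightarrow> k' < 0"
    by (auto simp: int_bits_def dest: nat_bits_inject)
  then have k: "k' = k" by linarith
  have "map (\<lambda>i. map (\<lambda>j. {i, j} \<in> E) [0..<n]) [0..<n] =
        map (\<lambda>i. map (\<lambda>j. {i, j} \<in> E') [0..<n]) [0..<n]"
    using adj unfolding adjacency_bits_def
    by (rule concat_injective) (auto simp: set_zip)
  then have *: "{i, j} \<in> E \<longleftrightarrow> {i, j} \<in> E'" if "i < n" "j < n" for i j
    using that by auto
  have "E = E'"
  proof (intro set_eqI)
    fix e
    show "e \<in> E \<longleftrightarrow> e \<in> E'"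
    proof (cases "e \<subseteq> {..<n} \<and> card e = 2")
      case True
      then obtain i j where "e = {i, j}" by (auto simp: card_2_iff)
      with True * show ?thesis by auto
    next
      case False
      with inst n show ?thesis by (auto simp: instances_def simple_graph_def)
    qed
  qed
  with n k show "x = y" by (simp add: x y)
qed

end

theory Submission
  imports Defs
begin

text \<open>
  The graph is mapped to its cone: a new vertex \<open>n\<close>, the apex, is joined to all the others.
  The rank of an edge set \<open>A\<close> is the number of vertices that are not the largest in their
  component of \<open>A\<close>; call these \<^emph>\<open>dominated\<close>.  Along an ordering of the edges of the cone the
  dominated sets of the prefixes form a chain, which induces an ordering \<open>\<pi>\<close> of the old vertices.
  An edge of \<open>A\<close> either joins two dominated vertices or joins a dominated vertex to the maximum of
  its component; sending an edge of the latter kind to the edge from that dominated vertex to the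
  apex shows that \<open>A\<close> has at most as many edges as the cone over its dominated vertices.  Hence
  taking the vertices in the order \<open>\<pi>\<close>, each one together with all cone edges to the apex and to
  earlier vertices, is at least as cheap, and this costs exactly
  \<open>n (n + 1) / 2\<close> more than \<open>\<pi>\<close> does for minimum latency vertex cover.

  The polynomial-time bound is established by an explicit machine, which adds \<open>n (n + 1) / 2\<close> to
  the threshold by counting.
\<close>

section \<open>The rank of an edge set\<close>

definition adj :: "'a set set \<Rightarrow> ('a \<times> 'a) set" where
  "adj A = {(x, y). {x, y} \<in> A}"

definition conn :: "'a set set \<Rightarrow> ('a \<times> 'a) set" where
  "conn A = (adj A)\<^sup>*"

text \<open>The maximum of a component serves as its representative, so the size of this set is the
  number of vertices minus the number of components. No vertex set has to be named: a vertex outside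
  \<open>\<Union>A\<close> is connected only to itself.\<close>

definition dominated :: "'a::linorder set set \<Rightarrow> 'a set" where
  "dominated A = {v. \<exists>w>v. (v, w) \<in> conn A}"

lemma sym_conn: "(x, y) \<in> conn A \<Longrightarrow> (y, x) \<in> conn A"
proof -
  have "sym (adj A)"
    by (auto simp: sym_def adj_def insert_commute)
  then show "(x, y) \<in> conn A \<Longrightarrow> (y, x) \<in> conn A"
    unfolding conn_def by (meson sym_rtrancl symD)
qed

lemma conn_refl [simp]: "(x, x) \<in> conn A"
  by (simp add: conn_def)

lemma conn_trans: "(x, y) \<in> conn A \<Longrightarrow> (y, z) \<in> conn A \<Longrightarrow> (x, z) \<in> conn A"
  unfolding conn_def by (rule rtrancl_trans)

lemma conn_edge: "{x, y} \<in> A \<Longrightarrow> (x, y) \<in> conn A"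
  by (auto simp: conn_def adj_def)

lemma conn_mono: "A \<subseteq> B \<Longrightarrow> conn A \<subseteq> conn B"
  unfolding conn_def by (rule rtrancl_mono) (auto simp: adj_def)

lemma conn_subset: "(x, y) \<in> conn A \<Longrightarrow> y = x \<or> y \<in> \<Union>A"
  unfolding conn_def by (induction rule: rtrancl_induct) (auto simp: adj_def)

lemma dominated_mono: "A \<subseteq> B \<Longrightarrow> dominated A \<subseteq> dominated B"
  using conn_mono[of A B] by (auto simp: dominated_def)

lemma dominated_subset: "dominated A \<subseteq> \<Union>A"
proof
  fix v assume "v \<in> dominated A"
  then obtain w where "w > v" "(w, v) \<in> conn A"
    by (auto simp: dominated_def intro: sym_conn)
  with conn_subset[of w v A] show "v \<in> \<Union>A" by auto
qed

text \<open>A walk can be shortened so that it crosses the new edge at most once, in one of the two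
  directions.\<close>

lemma conn_insert_edge:
  "(x, y) \<in> conn (insert {a, b} A) \<longleftrightarrow>
     (x, y) \<in> conn A \<or> (x, a) \<in> conn A \<and> (b, y) \<in> conn A \<or>
     (x, b) \<in> conn A \<and> (a, y) \<in> conn A" (is "_ \<longleftrightarrow> ?R y")
proof
  assume "(x, y) \<in> conn (insert {a, b} A)"
  then show "?R y" unfolding conn_def[of "insert _ _"]
  proof (induction rule: rtrancl_induct)
    case base
    show ?case by simp
  next
    case (step y z)
    from step.hyps(2) consider "{y, z} \<in> A" | "y = a" "z = b" | "y = b" "z = a"
      by (auto simp: adj_def doubleton_eq_iff)
    then show ?case
    proof cases
      case 1
      with step.IH show ?thesis by (meson conn_edge conn_trans)
    qed (use step.IH in \<open>auto intro: conn_trans sym_conn\<close>)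
  qed
next
  have *: "(a, b) \<in> conn (insert {a, b} A)" by (simp add: conn_edge)
  have "conn A \<subseteq> conn (insert {a, b} A)" by (rule conn_mono) auto
  with * show "?R y \<Longrightarrow> (x, y) \<in> conn (insert {a, b} A)"
    by (meson conn_trans sym_conn subsetD)
qed

lemma finite_component: "finite (\<Union>A) \<Longrightarrow> finite {w. (x, w) \<in> conn A}"
  by (rule finite_subset[of _ "insert x (\<Union>A)"]) (use conn_subset[of x _ A] in blast)+

lemma Max_component:
  fixes A :: "'a::linorder set set"
  assumes "finite (\<Union>A)"
  shows "(x, Max {w. (x, w) \<in> conn A}) \<in> conn A"
proof -
  have "x \<in> {w. (x, w) \<in> conn A}" by simp
  then have "Max {w. (x, w) \<in> conn A} \<in> {w. (x, w) \<in> conn A}"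
    by (intro Max_in finite_component assms) blast
  then show ?thesis by simp
qed

text \<open>Joining two components leaves the larger of their maxima on top, so the smaller maximum
  is the only vertex that becomes dominated.\<close>

lemma card_dominated_insert:
  fixes A :: "'a::linorder set set"
  assumes fin: "finite (\<Union>A)" and ab: "(a, b) \<notin> conn A"
  shows "card (dominated (insert {a, b} A)) = Suc (card (dominated A))"
proof -
  \<comment> \<open>Stated for fresh \<open>a\<close> and \<open>b\<close>, with the smaller maximum
    on the side of \<open>a\<close>, so that it applies to either orientation of the edge.\<close>
  have main: "card (dominated (insert {a, b} A)) = Suc (card (dominated A))"
    if ab: "(a, b) \<notin> conn A"
      and less: "Max {w. (a, w) \<in> conn A} < Max {w. (b, w) \<in> conn A}" (is "?ra < ?rb") for a b
  proof -
    have finc: "finite {w. (x, w) \<in> conn A}" for x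
      using fin by (rule finite_component)
    have ra: "(a, ?ra) \<in> conn A" and rb: "(b, ?rb) \<in> conn A"
      by (rule Max_component[OF fin])+
    have ge: "w \<le> ?ra" if "(a, w) \<in> conn A" for w
      using finc that by simp
    have max_a: "?ra \<notin> dominated A"
    proof
      assume "?ra \<in> dominated A"
      then obtain w where "w > ?ra" "(?ra, w) \<in> conn A" by (auto simp: dominated_def)
      with ge[OF conn_trans[OF ra]] show False by force
    qed
    have "dominated (insert {a, b} A) = insert ?ra (dominated A)"
    proof (intro set_eqI iffI)
      fix x assume "x \<in> dominated (insert {a, b} A)"
      then obtain w where w: "w > x" "(x, w) \<in> conn (insert {a, b} A)"
        by (auto simp: dominated_def)
      show "x \<in> insert ?ra (dominated A)"
      proof (rule ccontr)
        assume "x \<notin> insert ?ra (dominated A)"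
        then have x: "x \<noteq> ?ra" and max: "\<And>z. (x, z) \<in> conn A \<Longrightarrow> z \<le> x"
          by (auto simp: dominated_def not_less[symmetric])
        have "(x, w) \<notin> conn A"
        proof
          assume "(x, w) \<in> conn A"
          then have "w \<le> x" by (rule max)
          with w(1) show False by simp
        qed
        \<comment> \<open>The connection from \<open>x\<close> to \<open>w\<close> must use the new
          edge. On the side of \<open>a\<close> only \<open>?ra\<close> is undominated; on the side
          of \<open>b\<close>, \<open>x\<close> would be at least \<open>?rb\<close> and hence above
          \<open>w\<close>.\<close>
        then consider "(x, a) \<in> conn A" | "(x, b) \<in> conn A" "(a, w) \<in> conn A"
          using w by (auto simp: conn_insert_edge)
        then show False
        proof cases
          case 1
          then have "?ra \<le> x" using max[OF conn_trans[OF _ ra]] by blast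
          moreover have "x \<le> ?ra" using ge sym_conn[OF 1] by blast
          ultimately show False using x by simp
        next
          case 2
          then have "?rb \<le> x" using max[OF conn_trans[OF _ rb]] by blast
          moreover have "w \<le> ?ra" using ge 2 by blast
          ultimately show False using w less by simp
        qed
      qed
    next
      fix x assume "x \<in> insert ?ra (dominated A)"
      moreover have "(?ra, ?rb) \<in> conn (insert {a, b} A)"
        using ra rb by (auto simp: conn_insert_edge intro: sym_conn)
      ultimately show "x \<in> dominated (insert {a, b} A)"
        using less dominated_mono[of A "insert {a, b} A"] by (auto simp: dominated_def)
    qed
    moreover have "finite (dominated A)"
      using dominated_subset fin by (rule finite_subset)
    ultimately show ?thesis using max_a by simp
  qed
  have "(a, Max {w. (a, w) \<in> conn A}) \<in> conn A" "(b, Max {w. (b, w) \<in> conn A}) \<in> conn A"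
    by (rule Max_component[OF fin])+
  then have "Max {w. (a, w) \<in> conn A} \<noteq> Max {w. (b, w) \<in> conn A}"
    using ab by (metis conn_trans sym_conn)
  moreover have "(b, a) \<notin> conn A" using ab sym_conn[of b a A] by blast
  ultimately consider "Max {w. (a, w) \<in> conn A} < Max {w. (b, w) \<in> conn A}"
    | "Max {w. (b, w) \<in> conn A} < Max {w. (a, w) \<in> conn A}" "(b, a) \<notin> conn A"
    by (meson linorder_neqE)
  then show ?thesis
  proof cases
    case 1
    with ab show ?thesis by (rule main)
  next
    case 2
    from main[OF 2(2,1)] show ?thesis by (simp only: insert_commute[of b a])
  qed
qed

section \<open>Paths, cycles and forests\<close>

lemma conn_distinct_path:
  assumes "(x, y) \<in> conn A"
  shows "\<exists>vs. vs \<noteq> [] \<and> hd vs = x \<and> last vs = y \<and> distinct vs \<and>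
           (\<forall>i. Suc i < length vs \<longrightarrow> {vs ! i, vs ! Suc i} \<in> A)"
  using assms unfolding conn_def
proof (induction rule: rtrancl_induct)
  case base
  show ?case by (rule exI[of _ "[x]"]) simp
next
  case (step y z)
  then obtain vs where vs: "vs \<noteq> []" "hd vs = x" "last vs = y" "distinct vs"
    "\<And>i. Suc i < length vs \<Longrightarrow> {vs ! i, vs ! Suc i} \<in> A" by blast
  show ?case
  proof (cases "z \<in> set vs")
    case True
    \<comment> \<open>The walk returns to a vertex already visited, so the path is cut back to
      it.\<close>
    then obtain k where k: "k < length vs" "vs ! k = z" by (auto simp: in_set_conv_nth)
    then have "last (take (Suc k) vs) = z" by (simp add: take_Suc_conv_app_nth)
    with vs k show ?thesis
      by (intro exI[of _ "take (Suc k) vs"]) (auto simp: hd_take)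
  next
    case False
    have "{(vs @ [z]) ! i, (vs @ [z]) ! Suc i} \<in> A" if "Suc i < length (vs @ [z])" for i
    proof (cases "Suc i < length vs")
      case True
      with vs(5) show ?thesis by (simp add: nth_append)
    next
      case False
      with that have "i = length vs - 1" "Suc i = length vs" by auto
      then show ?thesis
        using vs step.hyps(2) by (auto simp: nth_append adj_def last_conv_nth)
    qed
    with vs False show ?thesis
      by (intro exI[of _ "vs @ [z]"]) auto
  qed
qed

text \<open>A simple path in \<open>A\<close> from \<open>a\<close> to \<open>b\<close> would close
  up with \<open>{a, b}\<close> to a cycle.\<close>

lemma acyclic_insert_not_conn:
  assumes "acyclic_edges (insert {a, b} A)" "{a, b} \<notin> A" "a \<noteq> b"
  shows "(a, b) \<notin> conn A"
proof
  assume "(a, b) \<in> conn A"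
  then obtain vs where vs: "vs \<noteq> []" "hd vs = a" "last vs = b" "distinct vs"
    "\<And>i. Suc i < length vs \<Longrightarrow> {vs ! i, vs ! Suc i} \<in> A"
    using conn_distinct_path[of a b A] by auto
  have ends: "vs ! 0 = a" "vs ! (length vs - 1) = b"
    using vs by (auto simp: hd_conv_nth last_conv_nth)
  \<comment> \<open>A path on one vertex would give \<open>a = b\<close>, and one on two vertices
    would put \<open>{a, b}\<close> into \<open>A\<close>; a cycle needs at least three
    vertices.\<close>
  have "length vs \<noteq> 1" using ends assms by auto
  moreover have "length vs \<noteq> 2"
  proof
    assume 2: "length vs = 2"
    with vs(5)[of 0] ends assms show False by (simp add: numeral_2_eq_2)
  qed
  ultimately have len: "length vs \<ge> 3" using vs(1) by (cases "length vs") auto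
  have "{vs ! i, vs ! (Suc i mod length vs)} \<in> insert {a, b} A" if "i < length vs" for i
  proof (cases "Suc i < length vs")
    case True
    then show ?thesis using vs(5) by simp
  next
    case False
    with that have "i = length vs - 1" "Suc i mod length vs = 0"
      by (auto simp: not_less_eq less_Suc_eq)
    then show ?thesis using ends by (auto simp: insert_commute)
  qed
  with len vs(4) have "is_cycle (insert {a, b} A) vs" by (simp add: is_cycle_def)
  with assms(1) show False by (auto simp: acyclic_edges_def)
qed

lemma conn_walk:
  assumes "\<And>j. i \<le> j \<Longrightarrow> j < k \<Longrightarrow> (g j, g (Suc j)) \<in> conn A" "i \<le> k"
  shows "(g i, g k) \<in> conn A"
  using assms(2,1)
proof (induction k rule: dec_induct)
  case base
  show ?case by simp
next
  case (step k)
  then have "(g i, g k) \<in> conn A" "(g k, g (Suc k)) \<in> conn A" by auto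
  then show ?case by (rule conn_trans)
qed

text \<open>The cycle does not lie in \<open>A\<close>, so it uses \<open>{a, b}\<close>, and it
  does so only once; going round the other way connects the two ends inside
  \<open>A\<close>.\<close>

lemma cycle_insert_conn:
  assumes cyc: "is_cycle (insert {a, b} A) vs" and "acyclic_edges A"
  shows "(a, b) \<in> conn A"
proof -
  let ?n = "length vs"
  \<comment> \<open>Positions are read cyclically, so that the rest of the cycle is the single
    stretch from \<open>Suc k\<close> to \<open>k + ?n\<close>.\<close>
  define g where "g i = vs ! (i mod ?n)" for i
  have n: "?n \<ge> 3" and dist: "distinct vs"
    and edge: "\<And>i. i < ?n \<Longrightarrow> {vs ! i, vs ! (Suc i mod ?n)} \<in> insert {a, b} A"
    using cyc by (auto simp: is_cycle_def)
  from assms have "\<not> is_cycle A vs" by (auto simp: acyclic_edges_def)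
  with n dist obtain k where k: "k < ?n" "{vs ! k, vs ! (Suc k mod ?n)} \<notin> A"
    by (auto simp: is_cycle_def)
  then have kab: "{g k, g (Suc k)} = {a, b}" using edge[of k] by (auto simp: g_def)
  have other: "(g j, g (Suc j)) \<in> conn A" if "Suc k \<le> j" "j < k + ?n" for j
  proof -
    have lt: "j mod ?n < ?n" using n by (intro mod_less_divisor) linarith
    have lt': "Suc i mod ?n < ?n" for i using n by (intro mod_less_divisor) linarith
    have ne: "j mod ?n \<noteq> k"
    proof
      assume "j mod ?n = k"
      then show False
        using k that by (cases "j < ?n") (auto simp: le_mod_geq)
    qed
    have inj: "vs ! p = vs ! q \<longleftrightarrow> p = q" if "p < ?n" "q < ?n" for p q
      using that dist by (simp add: nth_eq_iff_index_eq)
    \<comment> \<open>A second position carrying the same edge would carry it in reverse, so two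
      steps from \<open>k\<close> would lead back to \<open>k\<close>, which is impossible on a
      cycle of length at least 3.\<close>
    have "{g j, g (Suc j)} \<noteq> {g k, g (Suc k)}"
    proof
      assume "{g j, g (Suc j)} = {g k, g (Suc k)}"
      then have "g j = g (Suc k) \<and> g (Suc j) = g k"
        using ne inj[of "j mod ?n" k] lt k by (auto simp: g_def doubleton_eq_iff)
      then have *: "j mod ?n = Suc k mod ?n" "Suc j mod ?n = k"
        using inj[OF lt lt'[of k]] inj[OF lt'[of j] k(1)] k
        by (auto simp: g_def)
      then have "Suc (Suc k mod ?n) mod ?n = k" by (metis mod_Suc_eq)
      then have "Suc (Suc k) mod ?n = k" by (simp add: mod_Suc_eq)
      with n k show False by (auto simp: mod_if split: if_splits)
    qed
    moreover have "{g j, g (Suc j)} \<in> insert {a, b} A"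
      using edge[OF lt] by (simp add: g_def mod_Suc_eq)
    ultimately show ?thesis unfolding kab by (intro conn_edge) blast
  qed
  have "(g (Suc k), g (k + ?n)) \<in> conn A"
    by (rule conn_walk) (use other n in auto)
  then have "(g (Suc k), g k) \<in> conn A" by (simp add: g_def)
  with kab show ?thesis by (auto simp: doubleton_eq_iff intro: sym_conn)
qed

lemma acyclic_mono: "acyclic_edges B \<Longrightarrow> A \<subseteq> B \<Longrightarrow> acyclic_edges A"
  by (force simp: acyclic_edges_def is_cycle_def)

text \<open>When a forest is built up edge by edge, every edge joins two different components, so
  both sides grow by one.\<close>

lemma card_acyclic:
  fixes F :: "'a::linorder set set"
  assumes "finite F" "\<forall>e\<in>F. card e = 2" "acyclic_edges F"
  shows "card F = card (dominated F)"
  using assms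
proof (induction F rule: finite_induct)
  case empty
  have "dominated {} = ({} :: 'a set)" using dominated_subset[of "{}"] by auto
  then show ?case by simp
next
  case (insert e F)
  then obtain a b where e: "e = {a, b}" "a \<noteq> b" by (auto simp: card_2_iff)
  have "(a, b) \<notin> conn F"
    using insert.prems insert.hyps e by (intro acyclic_insert_not_conn) auto
  moreover have "finite (\<Union>F)" 
    using insert.hyps insert.prems by (intro finite_Union) (auto intro: card_ge_0_finite)
  moreover have "acyclic_edges F" using insert.prems by (auto elim: acyclic_mono)
  ultimately show ?case using insert e by (simp add: card_dominated_insert)
qed

text \<open>For a largest acyclic subset \<open>F\<close>, every other edge of \<open>A\<close>
  closes a cycle with \<open>F\<close>, so its ends are connected in \<open>F\<close> already. Hence
  \<open>F\<close> and \<open>A\<close> have the same components and the same dominated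
  vertices.\<close>

lemma graphic_rank_eq:
  fixes A :: "'a::linorder set set"
  assumes fin: "finite A" and two: "\<forall>e\<in>A. card e = 2"
  shows "graphic_rank A = card (dominated A)"
proof -
  let ?I = "{F. F \<subseteq> A \<and> acyclic_edges F}"
  have finI: "finite ?I" using fin by simp
  have "{} \<in> ?I" by (force simp: acyclic_edges_def is_cycle_def)
  then have "Max (card ` ?I) \<in> card ` ?I" using finI by (intro Max_in) blast+
  then obtain F where F: "F \<subseteq> A" "acyclic_edges F" "card F = graphic_rank A"
    by (auto simp: graphic_rank_def)
  have max: "card F' \<le> card F" if "F' \<subseteq> A" "acyclic_edges F'" for F'
    using that finI F by (simp add: graphic_rank_def)
  have "conn A \<subseteq> conn F"
  proof -
    have "(a, b) \<in> conn F" if ab: "{a, b} \<in> A" for a b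
    proof (cases "{a, b} \<in> F")
      case True
      then show ?thesis by (rule conn_edge)
    next
      case False
      have "finite F" using F(1) fin finite_subset by blast
      with False have "card (insert {a, b} F) > card F" by simp
      with max[of "insert {a, b} F"] F(1) ab obtain vs where "is_cycle (insert {a, b} F) vs"
        by (auto simp: acyclic_edges_def)
      with F(2) show ?thesis by (rule cycle_insert_conn[rotated -1])
    qed
    then have "adj A \<subseteq> conn F" by (auto simp: adj_def)
    then have "(adj A)\<^sup>* \<subseteq> (conn F)\<^sup>*" by (rule rtrancl_mono)
    then show ?thesis by (simp add: conn_def)
  qed
  then have "conn A = conn F" using conn_mono[OF F(1)] by blast
  then have "dominated A = dominated F" by (simp add: dominated_def)
  moreover have "card F = card (dominated F)"
    using F two fin by (intro card_acyclic) (auto intro: finite_subset)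
  ultimately show ?thesis using F(3) by simp
qed

section \<open>Orderings\<close>

text \<open>An element with the largest \<open>t\<close> gets the last position and the others are
  ordered recursively, ties being broken arbitrarily. It serves to sort edges by cost and vertices
  by time of entry into a chain.\<close>

lemma ex_sorting_bij:
  fixes t :: "'a \<Rightarrow> nat"
  assumes "finite V"
  shows "\<exists>\<pi>. bij_betw \<pi> V {1..card V} \<and> (\<forall>u\<in>V. \<forall>v\<in>V. t u < t v \<longrightarrow> \<pi> u < (\<pi> v :: nat))"
  using assms
proof (induction "card V" arbitrary: V)
  case 0
  then show ?case by (auto simp: bij_betw_def)
next
  case (Suc m)
  then have ne: "V \<noteq> {}" by auto
  have "Max (t ` V) \<in> t ` V" using ne Suc.prems by (intro Max_in) auto
  then obtain x where x: "x \<in> V" "t x = Max (t ` V)" by auto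
  have le: "t v \<le> t x" if "v \<in> V" for v
    using that Suc.prems unfolding x(2) by (intro Max_ge) auto
  from x(1) have m: "m = card (V - {x})" using Suc by simp
  then obtain \<pi> :: "'a \<Rightarrow> nat" where \<pi>: "bij_betw \<pi> (V - {x}) {1..m}"
    "\<forall>u\<in>V - {x}. \<forall>v\<in>V - {x}. t u < t v \<longrightarrow> \<pi> u < \<pi> v"
    using Suc.hyps(1)[OF m] Suc.prems by auto
  have "bij_betw (\<pi>(x := Suc m)) (V - {x}) {1..m}"
    using \<pi>(1) by (subst bij_betw_cong[of _ _ \<pi>]) auto
  then have "bij_betw (\<pi>(x := Suc m)) (V - {x} \<union> {x}) ({1..m} \<union> {(\<pi>(x := Suc m)) x})"
    by (subst notIn_Un_bij_betw3[symmetric]) auto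
  moreover have "V - {x} \<union> {x} = V" "{1..m} \<union> {Suc m} = {1..card V}"
    using x Suc.hyps(2) by auto
  ultimately have "bij_betw (\<pi>(x := Suc m)) V {1..card V}" by simp
  moreover have "\<pi> u \<le> m" if "u \<in> V - {x}" for u
    using bij_betwE[OF \<pi>(1)] that by auto
  moreover have "(\<pi>(x := Suc m)) u < (\<pi>(x := Suc m)) v" if "u \<in> V" "v \<in> V" "t u < t v" for u v
    using \<pi>(2) le[OF that(2)] that calculation(2)[of u] by (auto simp: less_Suc_eq_le)
  ultimately show ?case by blast
qed

text \<open>Once \<open>E\<close> is sorted by \<open>K\<close>, the hypothesis forces the
  \<open>i\<close>-th smallest value to be at most \<open>s i\<close>, and the sums are compared
  position by position.\<close>

lemma sum_le_sum_of_counts: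
  fixes K :: "'a \<Rightarrow> nat"
  assumes fin: "finite E"
    and count: "\<And>i. i \<in> {1..card E} \<Longrightarrow> i \<le> card {e \<in> E. K e \<le> s i}"
  shows "(\<Sum>e\<in>E. K e) \<le> (\<Sum>i=1..card E. s i)"
proof -
  obtain \<sigma> :: "'a \<Rightarrow> nat" where bij: "bij_betw \<sigma> E {1..card E}"
    and mono: "\<forall>u\<in>E. \<forall>v\<in>E. K u < K v \<longrightarrow> \<sigma> u < \<sigma> v"
    using ex_sorting_bij[OF fin, of K] by auto
  have "K e \<le> s (\<sigma> e)" if e: "e \<in> E" for e
  proof (rule ccontr)
    assume "\<not> K e \<le> s (\<sigma> e)"
    \<comment> \<open>Every element with \<open>K\<close> at most \<open>s (\<sigma> e)\<close>
      comes strictly before \<open>e\<close>, which leaves room for only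
      \<open>\<sigma> e - 1\<close> of them.\<close>
    then have "\<sigma> x \<in> {1..<\<sigma> e}" if "x \<in> {x \<in> E. K x \<le> s (\<sigma> e)}" for x
      using that e mono bij_betwE[OF bij] by auto
    then have "card {x \<in> E. K x \<le> s (\<sigma> e)} \<le> card {1..<\<sigma> e}"
      using inj_on_subset[OF bij_betw_imp_inj_on[OF bij]]
      by (intro card_inj_on_le[of \<sigma>]) (auto simp: subset_iff)
    moreover have "\<sigma> e \<in> {1..card E}" using bij_betwE[OF bij] e by blast
    ultimately show False using count[of "\<sigma> e"] by auto
  qed
  then have "(\<Sum>e\<in>E. K e) \<le> (\<Sum>e\<in>E. s (\<sigma> e))" by (rule sum_mono)
  also have "\<dots> = (\<Sum>i=1..card E. s i)" using bij by (rule sum.reindex_bij_betw)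
  finally show ?thesis .
qed

section \<open>The cone over a graph\<close>

text \<open>The apex is the largest number, so for edge sets of the cone it is never dominated and
  is the maximum of its component.\<close>

definition cone :: "nat \<Rightarrow> nat set set \<Rightarrow> nat set set" where
  "cone n E = E \<union> (\<lambda>v. {v, n}) ` {..<n}"

text \<open>A negative threshold makes both instances negative, so the machine need not add to it.\<close>

definition reduction :: "graph_instance \<Rightarrow> graph_instance" where
  "reduction = (\<lambda>(n, E, k). (Suc n, cone n E, if k < 0 then k else k + int (\<Sum>{1..n})))"

lemma finite_simple_graph: "simple_graph V E \<Longrightarrow> finite E"
  by (rule finite_subset[of _ "Pow V"]) (auto simp: simple_graph_def)

lemma simple_graph_cone: "simple_graph {..<n} E \<Longrightarrow> simple_graph {..<Suc n} (cone n E)"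
  by (fastforce simp: simple_graph_def cone_def card_2_iff)

lemma Union_cone: "simple_graph {..<n} E \<Longrightarrow> A \<subseteq> cone n E \<Longrightarrow> \<Union>A \<subseteq> {..n}"
  by (fastforce simp: simple_graph_def cone_def)

lemma dominated_cone:
  assumes G: "simple_graph {..<n} E" and A: "A \<subseteq> cone n E"
  shows "dominated A \<subseteq> {..<n}"
proof
  fix v assume "v \<in> dominated A"
  then obtain w where w: "w > v" "(v, w) \<in> conn A" by (auto simp: dominated_def)
  then have "w \<in> \<Union>A" using conn_subset[OF w(2)] by auto
  with Union_cone[OF G A] have "w \<le> n" by blast
  with w show "v \<in> {..<n}" by simp
qed

text \<open>Position 0 for the apex makes the edge \<open>{v, n}\<close> cost exactly
  \<open>\<pi> v\<close>, so the apex edges contribute \<open>1 + ... + n\<close> for every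
  \<open>\<pi>\<close>.\<close>

lemma cone_cost:
  assumes G: "simple_graph {..<n} E" and bij: "bij_betw \<pi> {..<n} {1..n}"
  shows "(\<Sum>e\<in>cone n E. Max ((\<pi>(n := 0)) ` e)) = mlvc_cost E \<pi> + \<Sum>{1..n}"
proof -
  have sub: "e \<subseteq> {..<n}" if "e \<in> E" for e
    using G that by (auto simp: simple_graph_def)
  have inj: "inj_on (\<lambda>v. {v, n}) {..<n}"
    by (auto simp: inj_on_def doubleton_eq_iff)
  have "(\<Sum>e\<in>cone n E. Max ((\<pi>(n := 0)) ` e)) =
      (\<Sum>e\<in>E. Max ((\<pi>(n := 0)) ` e)) + (\<Sum>e\<in>(\<lambda>v. {v, n}) ` {..<n}. Max ((\<pi>(n := 0)) ` e))"
    unfolding cone_def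
    by (rule sum.union_disjoint) (use sub finite_simple_graph[OF G] in auto)
  also have "(\<Sum>e\<in>E. Max ((\<pi>(n := 0)) ` e)) = mlvc_cost E \<pi>"
    unfolding mlvc_cost_def
  proof (rule sum.cong)
    fix e assume "e \<in> E"
    with sub have "(\<pi>(n := 0)) ` e = \<pi> ` e" by (intro image_cong) auto
    then show "Max ((\<pi>(n := 0)) ` e) = Max (\<pi> ` e)" by simp
  qed simp
  also have "(\<Sum>e\<in>(\<lambda>v. {v, n}) ` {..<n}. Max ((\<pi>(n := 0)) ` e)) = (\<Sum>v<n. \<pi> v)"
    by (simp add: sum.reindex[OF inj])
  also have "\<dots> = \<Sum>{1..n}"
    using sum.reindex_bij_betw[OF bij, of "\<lambda>x. x"] by simp
  finally show ?thesis .
qed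

text \<open>The cone edges are sorted by \<open>K\<close>, the position of their later end, with the
  apex at 0. The prefix ending at \<open>e\<close> touches only vertices of position at most
  \<open>K e\<close>, so its rank is at most \<open>K e\<close>.\<close>

lemma mlop_cost_le:
  assumes G: "simple_graph {..<n} E" and bij: "bij_betw \<pi> {..<n} {1..n}"
  shows "\<exists>\<sigma>. bij_betw \<sigma> (cone n E) {1..card (cone n E)} \<and>
           mlop_cost (cone n E) \<sigma> \<le> mlvc_cost E \<pi> + \<Sum>{1..n}"
proof -
  let ?H = "cone n E"
  define \<pi>' where "\<pi>' = \<pi>(n := 0)"
  define K where "K e = Max (\<pi>' ` e)" for e
  note H = simple_graph_cone[OF G]
  have finH: "finite ?H" using finite_simple_graph[OF H] .
  have fine: "finite e" if "e \<in> ?H" for e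
    using H that by (auto simp: simple_graph_def intro: finite_subset)
  obtain \<sigma> :: "nat set \<Rightarrow> nat" where \<sigma>: "bij_betw \<sigma> ?H {1..card ?H}"
    and mono: "\<forall>u\<in>?H. \<forall>v\<in>?H. K u < K v \<longrightarrow> \<sigma> u < \<sigma> v"
    using ex_sorting_bij[OF finH, of K] by auto
  have "graphic_rank {x \<in> ?H. \<sigma> x \<le> \<sigma> e} \<le> K e" if e: "e \<in> ?H" for e
  proof -
    let ?A = "{x \<in> ?H. \<sigma> x \<le> \<sigma> e}"
    have "\<pi>' v \<le> K e" if "v \<in> x" "x \<in> ?A" for v x
    proof -
      have "\<pi>' v \<le> K x" unfolding K_def using that fine by (intro Max_ge) auto
      also have "K x \<le> K e" using mono that e by (force simp: not_less[symmetric])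
      finally show ?thesis .
    qed
    then have "\<pi>' v \<le> K e" if "v \<in> dominated ?A" for v
      using that dominated_subset[of ?A] by blast
    moreover have "dominated ?A \<subseteq> {..<n}" by (rule dominated_cone[OF G]) auto
    ultimately have dom: "dominated ?A \<subseteq> {v \<in> {..<n}. \<pi> v \<le> K e}" (is "_ \<subseteq> ?P")
      by (fastforce simp: \<pi>'_def)
    have "card (dominated ?A) \<le> card ?P" using dom by (intro card_mono) auto
    also have "\<dots> \<le> card {1..K e}"
      using bij_betwE[OF bij]
      by (intro card_inj_on_le[of \<pi>] inj_on_subset[OF bij_betw_imp_inj_on[OF bij]]) auto
    finally show ?thesis
      using H finH by (subst graphic_rank_eq) (auto simp: simple_graph_def)
  qed
  then have "(\<Sum>e\<in>?H. graphic_rank {x \<in> ?H. \<sigma> x \<le> \<sigma> e}) \<le> (\<Sum>e\<in>?H. K e)"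
    by (rule sum_mono)
  \<comment> \<open>As \<open>\<sigma>\<close> is a bijection onto the positions, the sum over
    prefixes is a sum over the edges that end them.\<close>
  moreover have "(\<Sum>e\<in>?H. graphic_rank {x \<in> ?H. \<sigma> x \<le> \<sigma> e}) = mlop_cost ?H \<sigma>"
    unfolding mlop_cost_def
    using sum.reindex_bij_betw[OF \<sigma>, of "\<lambda>i. graphic_rank {x \<in> ?H. \<sigma> x \<le> i}"] by simp
  ultimately show ?thesis
    using \<sigma> cone_cost[OF G bij] by (auto simp: K_def \<pi>'_def)
qed

text \<open>The map \<open>\<phi>\<close> is injective: a larger end that gets replaced is the
  maximum of its component and so is determined by the smaller end, while an edge that is kept never
  contains the apex.\<close>

lemma card_le_cone_edges_dominated:
  assumes G: "simple_graph {..<n} E" and A: "A \<subseteq> cone n E"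
  shows "card A \<le> card {e \<in> cone n E. e \<subseteq> insert n (dominated A)}"
proof -
  note H = simple_graph_cone[OF G]
  let ?D = "dominated A"
  define \<phi> where "\<phi> e = (if Max e \<in> ?D then e else {Min e, n})" for e
  have edge: "\<exists>a b. e = {a, b} \<and> a < b \<and> b \<le> n \<and> Min e = a \<and> Max e = b \<and> a \<in> ?D \<and> (a, b) \<in> conn A"
    if "e \<in> A" for e
  proof -
    have "card e = 2" "e \<subseteq> {..n}"
      using H A Union_cone[OF G A] that by (auto simp: simple_graph_def)
    then obtain a b where ab: "e = {a, b}" "a < b" "b \<le> n"
      by (auto simp: card_2_iff) (metis insert_commute linorder_neqE_nat)
    then have "(a, b) \<in> conn A" using that by (auto intro: conn_edge)
    with ab show ?thesis by (intro exI[of _ a] exI[of _ b]) (auto simp: dominated_def)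
  qed
  have apex: "n \<notin> ?D" using dominated_cone[OF G A] by auto
  have "inj_on \<phi> A"
  proof (rule inj_onI)
    fix e e' assume e: "e \<in> A" "e' \<in> A" "\<phi> e = \<phi> e'"
    obtain a b where ab: "e = {a, b}" "a < b" "b \<le> n" "Min e = a" "Max e = b" "(a, b) \<in> conn A"
      using edge[OF e(1)] by blast
    obtain c d where cd: "e' = {c, d}" "c < d" "d \<le> n" "Min e' = c" "Max e' = d" "(c, d) \<in> conn A"
      using edge[OF e(2)] by blast
    consider "b \<in> ?D" "d \<in> ?D" | "b \<in> ?D" "d \<notin> ?D" | "b \<notin> ?D" "d \<in> ?D" | "b \<notin> ?D" "d \<notin> ?D"
      by blast
    then show "e = e'"
    proof cases
      case 1
      then show ?thesis using e(3) by (simp add: \<phi>_def ab(5) cd(5))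
    next
      case 2
      \<comment> \<open>A kept edge has both ends dominated, so it cannot contain the apex; this
        case and the next are contradictory.\<close>
      then have "{a, b} = {c, n}" using e(3) by (simp add: \<phi>_def ab cd)
      then show ?thesis using ab cd apex 2 by (auto simp: doubleton_eq_iff)
    next
      case 3
      then have "{a, n} = {c, d}" using e(3) by (simp add: \<phi>_def ab cd)
      then show ?thesis using ab cd apex 3 by (auto simp: doubleton_eq_iff)
    next
      case 4
      then have "{a, n} = {c, n}" using e(3) by (simp add: \<phi>_def ab cd)
      then have "a = c" by (auto simp: doubleton_eq_iff)
      \<comment> \<open>Both \<open>b\<close> and \<open>d\<close> are undominated in the component
        of \<open>a = c\<close>, so each is its maximum.\<close>
      then have "(b, d) \<in> conn A" using ab(6) cd(6) by (meson conn_trans sym_conn)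
      then have "b = d" using 4 sym_conn[of b d A] by (auto simp: dominated_def elim: linorder_neqE_nat)
      with \<open>a = c\<close> show ?thesis by (simp add: ab(1) cd(1))
    qed
  qed
  moreover have "\<phi> ` A \<subseteq> {e \<in> cone n E. e \<subseteq> insert n ?D}"
  proof (intro image_subsetI)
    fix e assume e: "e \<in> A"
    obtain a b where ab: "e = {a, b}" "a < b" "b \<le> n" "Min e = a" "Max e = b" "a \<in> ?D"
      using edge[OF e] by blast
    show "\<phi> e \<in> {e \<in> cone n E. e \<subseteq> insert n ?D}"
    proof (cases "b \<in> ?D")
      case True
      then show ?thesis using ab e A by (auto simp: \<phi>_def)
    next
      case False
      then have "\<phi> e = {a, n}" using ab by (simp add: \<phi>_def)
      with ab show ?thesis by (auto simp: cone_def)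
    qed
  qed
  ultimately show ?thesis
    using finite_simple_graph[OF H] by (intro card_inj_on_le[of \<phi>]) auto
qed

text \<open>Elements are ordered by the time at which they enter the chain, so each
  \<open>S i\<close> with \<open>i \<le> m\<close> fills an initial segment of positions.\<close>

lemma ex_bij_initial_segments:
  fixes S :: "nat \<Rightarrow> 'a set"
  assumes "finite V" "\<And>i. S i \<subseteq> V" and mono: "\<And>i j. i \<le> j \<Longrightarrow> S i \<subseteq> S j"
  shows "\<exists>\<pi>. bij_betw \<pi> V {1..card V} \<and> (\<forall>i\<le>m. \<forall>v\<in>S i. \<pi> v \<le> card (S i))"
proof -
  \<comment> \<open>Because the chain is increasing, \<open>t v\<close> is the time of entry; an
    element that has not entered by time \<open>m\<close> gets the value
    \<open>Suc m\<close>.\<close>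
  define t where "t v = card {i. i \<le> m \<and> v \<notin> S i}" for v
  obtain \<pi> :: "'a \<Rightarrow> nat" where bij: "bij_betw \<pi> V {1..card V}"
    and \<pi>: "\<forall>u\<in>V. \<forall>v\<in>V. t u < t v \<longrightarrow> \<pi> u < \<pi> v"
    using ex_sorting_bij[OF assms(1), of t] by auto
  have "\<pi> v \<le> card (S i)" if i: "i \<le> m" and v: "v \<in> S i" for i v
  proof -
    have "u \<in> S i" if u: "u \<in> V" "\<pi> u \<le> \<pi> v" for u
    proof (rule ccontr)
      assume nu: "u \<notin> S i"
      have "j < i" if "v \<notin> S j" for j
        using mono[of i j] v that by (cases "i \<le> j") auto
      then have "{j. j \<le> m \<and> v \<notin> S j} \<subseteq> {j. j \<le> m \<and> u \<notin> S j}"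
        using mono[OF less_imp_le] nu by blast
      moreover have "i \<in> {j. j \<le> m \<and> u \<notin> S j}" "i \<notin> {j. j \<le> m \<and> v \<notin> S j}"
        using nu i v by auto
      ultimately have "t v < t u" unfolding t_def by (intro psubset_card_mono) auto
      with \<pi> u v assms(2) show False by (meson not_less subsetD)
    qed
    then have sub: "{u \<in> V. \<pi> u \<le> \<pi> v} \<subseteq> S i" by blast
    have "v \<in> V" using v assms(2) by blast
    then have le: "\<pi> v \<le> card V" using bij_betwE[OF bij] by auto
    have "\<pi> ` {u \<in> V. \<pi> u \<le> \<pi> v} = {1..\<pi> v}"
    proof (intro set_eqI iffI)
      fix x assume x: "x \<in> {1..\<pi> v}"
      then have "x \<in> \<pi> ` V" using bij_betw_imp_surj_on[OF bij] le by auto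
      then show "x \<in> \<pi> ` {u \<in> V. \<pi> u \<le> \<pi> v}" using x by auto
    qed (use bij_betwE[OF bij] in auto)
    then have "\<pi> v = card (\<pi> ` {u \<in> V. \<pi> u \<le> \<pi> v})" by simp
    also have "\<dots> \<le> card {u \<in> V. \<pi> u \<le> \<pi> v}" using assms(1) by (intro card_image_le) auto
    also have "\<dots> \<le> card (S i)"
      using sub assms(1) finite_subset[OF assms(2)] by (intro card_mono) auto
    finally show ?thesis .
  qed
  with bij show ?thesis by blast
qed

text \<open>The \<open>i\<close> edges of a prefix are at most as many as the cone edges over its
  dominated set. With \<open>\<pi>\<close> taken from the chain of dominated sets, each of those
  cone edges has \<open>K\<close> at most the rank of the prefix. So at least \<open>i\<close> edges
  have \<open>K\<close> at most the \<open>i\<close>-th rank, as \<open>sum_le_sum_of_counts\<close>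
  requires.\<close>

lemma mlop_cost_ge:
  assumes G: "simple_graph {..<n} E" and \<sigma>: "bij_betw \<sigma> (cone n E) {1..card (cone n E)}"
  shows "\<exists>\<pi>. bij_betw \<pi> {..<n} {1..n} \<and> mlvc_cost E \<pi> + \<Sum>{1..n} \<le> mlop_cost (cone n E) \<sigma>"
proof -
  let ?H = "cone n E" and ?m = "card (cone n E)"
  note H = simple_graph_cone[OF G]
  have finH: "finite ?H" using finite_simple_graph[OF H] .
  define A where "A i = {e \<in> ?H. \<sigma> e \<le> i}" for i
  have AH: "A i \<subseteq> ?H" for i by (auto simp: A_def)
  have dom: "dominated (A i) \<subseteq> {..<n}" for i using dominated_cone[OF G AH] .
  have "\<exists>\<pi>. bij_betw \<pi> {..<n} {1..card {..<n}} \<and>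
      (\<forall>i\<le>?m. \<forall>v\<in>dominated (A i). \<pi> v \<le> card (dominated (A i)))"
    by (rule ex_bij_initial_segments[OF _ dom]) (auto intro!: dominated_mono simp: A_def)
  then obtain \<pi> where \<pi>: "bij_betw \<pi> {..<n} {1..n}"
    and le: "\<And>i v. i \<le> ?m \<Longrightarrow> v \<in> dominated (A i) \<Longrightarrow> \<pi> v \<le> card (dominated (A i))"
    by auto
  define K where "K e = Max ((\<pi>(n := 0)) ` e)" for e
  have "i \<le> card {e \<in> ?H. K e \<le> card (dominated (A i))}" if i: "i \<in> {1..?m}" for i
  proof -
    have "\<sigma> ` A i = {1..i}"
    proof (intro set_eqI iffI)
      fix x assume x: "x \<in> {1..i}"
      then have "x \<in> \<sigma> ` ?H" using bij_betw_imp_surj_on[OF \<sigma>] i by auto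
      then show "x \<in> \<sigma> ` A i" using x by (auto simp: A_def)
    qed (use bij_betwE[OF \<sigma>] in \<open>auto simp: A_def\<close>)
    then have "i = card (\<sigma> ` A i)" by simp
    also have "\<dots> \<le> card (A i)" using finH by (intro card_image_le) (simp add: A_def)
    also have "\<dots> \<le> card {e \<in> ?H. e \<subseteq> insert n (dominated (A i))}"
      by (rule card_le_cone_edges_dominated[OF G AH])
    also have "\<dots> \<le> card {e \<in> ?H. K e \<le> card (dominated (A i))}"
    proof (rule card_mono)
      show "{e \<in> ?H. e \<subseteq> insert n (dominated (A i))} \<subseteq> {e \<in> ?H. K e \<le> card (dominated (A i))}"
      proof (intro subsetI CollectI conjI)
        fix e assume "e \<in> {e \<in> ?H. e \<subseteq> insert n (dominated (A i))}"
        then have e: "e \<in> ?H" "e \<subseteq> insert n (dominated (A i))" by auto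
        then show "e \<in> ?H" by simp
        have "card e = 2" using e(1) H by (auto simp: simple_graph_def)
        then have "finite e" "e \<noteq> {}" by (auto intro: card_ge_0_finite)
        moreover have "(\<pi>(n := 0)) v \<le> card (dominated (A i))" if "v \<in> e" for v
          using that e(2) le[of i v] i by auto
        ultimately show "K e \<le> card (dominated (A i))"
          unfolding K_def by (intro Max.boundedI) blast+
      qed
    qed (use finH in simp)
    finally show ?thesis .
  qed
  then have "(\<Sum>e\<in>?H. K e) \<le> (\<Sum>i=1..?m. card (dominated (A i)))"
    by (rule sum_le_sum_of_counts[OF finH])
  also have "\<dots> = mlop_cost ?H \<sigma>"
    unfolding mlop_cost_def
  proof (rule sum.cong)
    fix i
    show "card (dominated (A i)) = graphic_rank {e \<in> ?H. \<sigma> e \<le> i}"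
      using H finH by (subst graphic_rank_eq) (auto simp: simple_graph_def A_def)
  qed simp
  finally show ?thesis
    using \<pi> cone_cost[OF G \<pi>] by (auto simp: K_def)
qed

lemma reduction_correct:
  assumes "x \<in> instances"
  shows "reduction x \<in> instances" "x \<in> MLVC \<longleftrightarrow> reduction x \<in> Graphic_MLOP"
proof -
  obtain n E k where x: "x = (n, E, k)" by (metis prod_cases3)
  with assms have G: "simple_graph {..<n} E" by (simp add: instances_def)
  show inst: "reduction x \<in> instances"
    using simple_graph_cone[OF G] by (simp add: x reduction_def instances_def)
  show "x \<in> MLVC \<longleftrightarrow> reduction x \<in> Graphic_MLOP"
  proof (cases "k < 0")
    case True
    then show ?thesis by (auto simp: x reduction_def MLVC_def Graphic_MLOP_def)
  next
    case False
    have "(\<exists>\<pi>. bij_betw \<pi> {..<n} {1..n} \<and> int (mlvc_cost E \<pi>) \<le> k) \<longleftrightarrow>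
      (\<exists>\<sigma>. bij_betw \<sigma> (cone n E) {1..card (cone n E)} \<and>
         int (mlop_cost (cone n E) \<sigma>) \<le> k + int (\<Sum>{1..n}))" (is "?L \<longleftrightarrow> ?R")
    proof
      assume ?L
      then obtain \<pi> where "bij_betw \<pi> {..<n} {1..n}" "int (mlvc_cost E \<pi>) \<le> k" by blast
      with mlop_cost_le[OF G] show ?R by (smt (verit) of_nat_add of_nat_le_iff)
    next
      assume ?R
      then obtain \<sigma> where "bij_betw \<sigma> (cone n E) {1..card (cone n E)}"
        "int (mlop_cost (cone n E) \<sigma>) \<le> k + int (\<Sum>{1..n})" by blast
      with mlop_cost_ge[OF G] show ?L by (smt (verit) of_nat_add of_nat_le_iff)
    qed
    then show ?thesis
      using False assms inst by (auto simp: x reduction_def MLVC_def Graphic_MLOP_def)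
  qed
qed

section \<open>The machine\<close>

text \<open>
  Tape 0 is the input, tapes 1 and 2 hold \<open>n\<close> in unary as column and row counters, tape 3 is the
  output.  States 0--1 copy the unary prefix, 2--4 copy the rows, appending a one to each, 5 writes
  the row of the apex, 6 branches on the sign, and 7 copies a negative threshold.  A threshold that
  is not negative is copied by 8 with its sign bit replaced by the marker 3.  Then 9 returns to the
  marker and 10 increments the number, once per cell of tape 1 on each sweep; 11 and 12 shorten
  tape 1 by one cell and rewind it, which makes \<open>n + (n - 1) + \<dots> + 1\<close> increments in all.
\<close>

definition cone_delta :: "nat \<Rightarrow> nat list \<Rightarrow> nat \<times> (nat \<times> move) list" where
  "cone_delta q ss =
    (let x = ss ! 0; u = ss ! 1; v = ss ! 2; y = ss ! 3 in
     if q = 0 then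
       (if x = 2 then (0, [(2, Move_Right), (2, Move_Right), (2, Move_Right), (2, Move_Right)])
        else (1, [(x, Move_Right), (u, Move_Left), (v, Move_Left), (2, Move_Right)]))
     else if q = 1 then (2, [(x, Stay), (u, Stay), (v, Stay), (1, Move_Right)])
     else if q = 2 then
       (if v = 2 then (3, [(x, Stay), (u, Stay), (v, Move_Left), (y, Stay)])
        else (5, [(x, Stay), (u, Stay), (v, Stay), (y, Stay)]))
     else if q = 3 then
       (if u = 2 then (3, [(x, Move_Right), (u, Move_Left), (v, Stay), (x, Move_Right)])
        else (4, [(x, Stay), (u, Move_Right), (v, Stay), (2, Move_Right)]))
     else if q = 4 then
       (if u = 2 then (4, [(x, Stay), (u, Move_Right), (v, Stay), (y, Stay)])
        else (2, [(x, Stay), (u, Move_Left), (v, Stay), (y, Stay)]))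
     else if q = 5 then
       (if u = 2 then (5, [(x, Stay), (u, Move_Left), (v, Stay), (2, Move_Right)])
        else (6, [(x, Stay), (u, Move_Right), (v, Stay), (1, Move_Right)]))
     else if q = 6 then
       (if x = 2 then (7, [(x, Move_Right), (u, Stay), (v, Stay), (2, Move_Right)])
        else (8, [(x, Move_Right), (u, Stay), (v, Stay), (3, Move_Right)]))
     else if q = 7 then
       (if x = 0 then (13, [(x, Stay), (u, Stay), (v, Stay), (y, Stay)])
        else (7, [(x, Move_Right), (u, Stay), (v, Stay), (x, Move_Right)]))
     else if q = 8 then
       (if x = 0 then (9, [(x, Stay), (u, Stay), (v, Stay), (y, Move_Left)])
        else (8, [(x, Move_Right), (u, Stay), (v, Stay), (x, Move_Right)]))
     else if q = 9 then
       (if y \<noteq> 3 then (9, [(x, Stay), (u, Stay), (v, Stay), (y, Move_Left)])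
        else if u = 2 then (10, [(x, Stay), (u, Move_Right), (v, Stay), (y, Move_Right)])
        else (11, [(x, Stay), (u, Move_Left), (v, Stay), (y, Stay)]))
     else if q = 10 then
       (if y = 2 then (10, [(x, Stay), (u, Stay), (v, Stay), (1, Move_Right)])
        else (9, [(x, Stay), (u, Stay), (v, Stay), (2, Move_Left)]))
     else if q = 11 then
       (if u = 2 then (12, [(x, Stay), (0, Move_Left), (v, Stay), (y, Stay)])
        else (13, [(x, Stay), (u, Stay), (v, Stay), (1, Stay)]))
     else
       (if u = 2 then (12, [(x, Stay), (u, Move_Left), (v, Stay), (y, Stay)])
        else (9, [(x, Stay), (u, Move_Right), (v, Stay), (y, Stay)])))"

definition cone_tm :: tm where
  "cone_tm = \<lparr>ntapes = 4, nstates = 13, nsymbols = 4, delta = cone_delta\<rparr>"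

lemma turing_machine_cone_tm: "turing_machine cone_tm"
proof -
  have "fst (cone_delta q ss) \<le> 13 \<and> length (snd (cone_delta q ss)) = 4 \<and>
      fst ` set (snd (cone_delta q ss)) \<subseteq> {..<4}"
    if "length ss = 4" "set ss \<subseteq> {..<4}" for q ss
  proof -
    have "ss ! i < 4" if "i < 4" for i
      using that \<open>length ss = 4\<close> \<open>set ss \<subseteq> {..<4}\<close> nth_mem[of i ss]
      by (metis lessThan_iff subsetD)
    then have "ss ! 0 < 4" "ss ! 1 < 4" "ss ! 2 < 4" "ss ! 3 < 4" by simp_all
    then show ?thesis unfolding cone_delta_def Let_def by simp
  qed
  then show ?thesis by (simp add: turing_machine_def cone_tm_def)
qed

section \<open>Single steps and runs of bounded length\<close>

lemma step_cone:
  "step cone_tm (q, [(x, a), (u, b), (v, c), (y, d)]) =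
    (if q < 13 then
       let (q', acts) = cone_delta q [x a, u b, v c, y d]
       in (q', map2 (\<lambda>(t, h) (a, d). (t(h := a), h + offset d)) [(x, a), (u, b), (v, c), (y, d)] acts)
     else (q, [(x, a), (u, b), (v, c), (y, d)]))"
  by (simp add: step_def cone_tm_def)

text \<open>One equation per branch of \<open>cone_delta\<close>, so that simp can run the machine.
  Cells rewritten with their own symbol are cleared by \<open>fun_upd_idem\<close>, which keeps
  tapes that are only read syntactically unchanged.\<close>

lemma cone_step:
  "x a = 2 \<Longrightarrow> step cone_tm (0, [(x, a), (u, b), (v, c), (y, d)]) =
     (0, [(x, a + 1), (u(b := 2), b + 1), (v(c := 2), c + 1), (y(d := 2), d + 1)])"
  "x a \<noteq> 2 \<Longrightarrow> step cone_tm (0, [(x, a), (u, b), (v, c), (y, d)]) =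
     (1, [(x, a + 1), (u, b - 1), (v, c - 1), (y(d := 2), d + 1)])"
  "step cone_tm (1, [(x, a), (u, b), (v, c), (y, d)]) =
     (2, [(x, a), (u, b), (v, c), (y(d := 1), d + 1)])"
  "v c = 2 \<Longrightarrow> step cone_tm (2, [(x, a), (u, b), (v, c), (y, d)]) =
     (3, [(x, a), (u, b), (v, c - 1), (y, d)])"
  "v c \<noteq> 2 \<Longrightarrow> step cone_tm (2, [(x, a), (u, b), (v, c), (y, d)]) =
     (5, [(x, a), (u, b), (v, c), (y, d)])"
  "u b = 2 \<Longrightarrow> step cone_tm (3, [(x, a), (u, b), (v, c), (y, d)]) =
     (3, [(x, a + 1), (u, b - 1), (v, c), (y(d := x a), d + 1)])"
  "u b \<noteq> 2 \<Longrightarrow> step cone_tm (3, [(x, a), (u, b), (v, c), (y, d)]) =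
     (4, [(x, a), (u, b + 1), (v, c), (y(d := 2), d + 1)])"
  "u b = 2 \<Longrightarrow> step cone_tm (4, [(x, a), (u, b), (v, c), (y, d)]) =
     (4, [(x, a), (u, b + 1), (v, c), (y, d)])"
  "u b \<noteq> 2 \<Longrightarrow> step cone_tm (4, [(x, a), (u, b), (v, c), (y, d)]) =
     (2, [(x, a), (u, b - 1), (v, c), (y, d)])"
  "u b = 2 \<Longrightarrow> step cone_tm (5, [(x, a), (u, b), (v, c), (y, d)]) =
     (5, [(x, a), (u, b - 1), (v, c), (y(d := 2), d + 1)])"
  "u b \<noteq> 2 \<Longrightarrow> step cone_tm (5, [(x, a), (u, b), (v, c), (y, d)]) =
     (6, [(x, a), (u, b + 1), (v, c), (y(d := 1), d + 1)])"
  "x a = 2 \<Longrightarrow> step cone_tm (6, [(x, a), (u, b), (v, c), (y, d)]) =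
     (7, [(x, a + 1), (u, b), (v, c), (y(d := 2), d + 1)])"
  "x a \<noteq> 2 \<Longrightarrow> step cone_tm (6, [(x, a), (u, b), (v, c), (y, d)]) =
     (8, [(x, a + 1), (u, b), (v, c), (y(d := 3), d + 1)])"
  "x a = 0 \<Longrightarrow> step cone_tm (7, [(x, a), (u, b), (v, c), (y, d)]) =
     (13, [(x, a), (u, b), (v, c), (y, d)])"
  "x a \<noteq> 0 \<Longrightarrow> step cone_tm (7, [(x, a), (u, b), (v, c), (y, d)]) =
     (7, [(x, a + 1), (u, b), (v, c), (y(d := x a), d + 1)])"
  "x a = 0 \<Longrightarrow> step cone_tm (8, [(x, a), (u, b), (v, c), (y, d)]) =
     (9, [(x, a), (u, b), (v, c), (y, d - 1)])"
  "x a \<noteq> 0 \<Longrightarrow> step cone_tm (8, [(x, a), (u, b), (v, c), (y, d)]) =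
     (8, [(x, a + 1), (u, b), (v, c), (y(d := x a), d + 1)])"
  "y d \<noteq> 3 \<Longrightarrow> step cone_tm (9, [(x, a), (u, b), (v, c), (y, d)]) =
     (9, [(x, a), (u, b), (v, c), (y, d - 1)])"
  "y d = 3 \<Longrightarrow> u b = 2 \<Longrightarrow> step cone_tm (9, [(x, a), (u, b), (v, c), (y, d)]) =
     (10, [(x, a), (u, b + 1), (v, c), (y, d + 1)])"
  "y d = 3 \<Longrightarrow> u b \<noteq> 2 \<Longrightarrow> step cone_tm (9, [(x, a), (u, b), (v, c), (y, d)]) =
     (11, [(x, a), (u, b - 1), (v, c), (y, d)])"
  "y d = 2 \<Longrightarrow> step cone_tm (10, [(x, a), (u, b), (v, c), (y, d)]) =
     (10, [(x, a), (u, b), (v, c), (y(d := 1), d + 1)])"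
  "y d \<noteq> 2 \<Longrightarrow> step cone_tm (10, [(x, a), (u, b), (v, c), (y, d)]) =
     (9, [(x, a), (u, b), (v, c), (y(d := 2), d - 1)])"
  "u b = 2 \<Longrightarrow> step cone_tm (11, [(x, a), (u, b), (v, c), (y, d)]) =
     (12, [(x, a), (u(b := 0), b - 1), (v, c), (y, d)])"
  "u b \<noteq> 2 \<Longrightarrow> step cone_tm (11, [(x, a), (u, b), (v, c), (y, d)]) =
     (13, [(x, a), (u, b), (v, c), (y(d := 1), d)])"
  "u b = 2 \<Longrightarrow> step cone_tm (12, [(x, a), (u, b), (v, c), (y, d)]) =
     (12, [(x, a), (u, b - 1), (v, c), (y, d)])"
  "u b \<noteq> 2 \<Longrightarrow> step cone_tm (12, [(x, a), (u, b), (v, c), (y, d)]) =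
     (9, [(x, a), (u, b + 1), (v, c), (y, d)])"
  by (simp_all add: step_cone cone_delta_def Let_def fun_upd_idem)

text \<open>As in \<open>computes_within\<close>, \<open>T\<close> is only an upper bound, so
  estimates can be rounded up whenever runs are composed.\<close>

definition reach :: "nat \<Rightarrow> config \<Rightarrow> config \<Rightarrow> bool" where
  "reach T c c' \<longleftrightarrow> (\<exists>t\<le>T. (step cone_tm ^^ t) c = c')"

lemma reach_refl: "reach T c c"
  unfolding reach_def by (rule exI[of _ 0]) simp

lemma reach_trans:
  assumes "reach S c c'" "reach T c' c''" "S + T \<le> U"
  shows "reach U c c''"
proof -
  obtain s t where "s \<le> S" "t \<le> T" "(step cone_tm ^^ s) c = c'" "(step cone_tm ^^ t) c' = c''"
    using assms by (auto simp: reach_def)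
  then show ?thesis
    unfolding reach_def using assms(3) by (intro exI[of _ "t + s"]) (simp add: funpow_add)
qed

lemma reach_step:
  assumes "step cone_tm c = c'" "reach T c' c''"
  shows "reach (Suc T) c c''"
proof (rule reach_trans[OF _ assms(2)])
  show "reach 1 c c'" unfolding reach_def by (rule exI[of _ 1]) (simp add: assms(1))
qed simp

section \<open>Tape contents and the copying of the matrix\<close>

abbreviation symbol :: "bool \<Rightarrow> nat" where
  "symbol b \<equiv> (if b then 2 else 1)"

lemma word_tape_snoc:
  "(word_tape w)(int (length w) := symbol b) = word_tape (w @ [b])"
  by (rule ext) (auto simp: word_tape_def nth_append)

text \<open>Instances in which \<open>symbol b\<close> is already a numeral, the form in which
  \<open>cone_step\<close> writes a fixed bit.\<close>

lemmas word_tape_snoc_True = word_tape_snoc[where b = True, unfolded if_True]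
  and word_tape_snoc_False = word_tape_snoc[where b = False, unfolded if_False]

lemma word_tape_append: "word_tape (w @ b # z) (int (length w)) = symbol b"
  by (simp add: word_tape_def)

lemma word_tape_end: "word_tape w (int (length w)) = 0"
  by (simp add: word_tape_def)

abbreviation ones :: "nat \<Rightarrow> int \<Rightarrow> nat" where
  "ones n \<equiv> word_tape (replicate n True)"

lemma ones_snoc: "(ones n)(int n := 2) = ones (Suc n)"
  using word_tape_snoc[of "replicate n True" True] by (simp add: replicate_append_same)

lemma ones_eq: "ones n i = (if 0 \<le> i \<and> i < int n then 2 else 0)"
  by (auto simp: word_tape_def)

lemma ones_erase: "(ones (Suc n))(int n := 0) = ones n"
  by (rule ext) (auto simp: ones_eq simp del: replicate.simps)

text \<open>The output tape is filled along with the two counters because the output, too, begins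
  with a unary prefix. The induction runs over the cells still to be read, for any number
  \<open>i\<close> already read.\<close>

lemma read_unary:
  "reach m (0, [(word_tape (replicate i True @ replicate m True @ z), int i), (ones i, int i),
       (ones i, int i), (ones i, int i)])
     (0, [(word_tape (replicate (i + m) True @ z), int (i + m)), (ones (i + m), int (i + m)),
       (ones (i + m), int (i + m)), (ones (i + m), int (i + m))])"
proof (induction m arbitrary: i)
  case 0
  show ?case by (simp add: reach_refl)
next
  case (Suc m)
  let ?x = "word_tape (replicate i True @ replicate (Suc m) True @ z)"
  have x: "?x (int i) = 2"
    using word_tape_append[of "replicate i True" True "replicate m True @ z"] by simp
  have eq: "replicate i True @ replicate (Suc m) True @ z =
      replicate (Suc i) True @ replicate m True @ z"
    by (simp add: replicate_app_Cons_same)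
  show ?case
  proof (rule reach_step)
    show "step cone_tm (0, [(?x, int i), (ones i, int i), (ones i, int i), (ones i, int i)]) =
      (0, [(?x, int (Suc i)), (ones (Suc i), int (Suc i)), (ones (Suc i), int (Suc i)),
        (ones (Suc i), int (Suc i))])"
      using x fun_upd_triv[of ?x "int i"] by (simp add: cone_step ones_snoc)
    show "reach m (0, [(?x, int (Suc i)), (ones (Suc i), int (Suc i)), (ones (Suc i), int (Suc i)),
        (ones (Suc i), int (Suc i))])
      (0, [(word_tape (replicate (i + Suc m) True @ z), int (i + Suc m)), (ones (i + Suc m), int (i + Suc m)),
       (ones (i + Suc m), int (i + Suc m)), (ones (i + Suc m), int (i + Suc m))])"
      unfolding eq using Suc.IH[of "Suc i"] by simp
  qed
qed

text \<open>Tape 1 is traversed leftwards, its head staying at one less than the number of entries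
  still to copy; the blank at cell -1 will end the row.\<close>

lemma copy_row:
  assumes "length bs \<le> n"
  shows "reach (length bs)
     (3, [(word_tape (p @ bs @ z), int (length p)), (ones n, int (length bs) - 1), (v, c),
       (word_tape w, int (length w))])
     (3, [(word_tape (p @ bs @ z), int (length (p @ bs))), (ones n, -1), (v, c),
       (word_tape (w @ bs), int (length (w @ bs)))])"
  using assms
proof (induction bs arbitrary: p w)
  case Nil
  show ?case by (simp add: reach_refl)
next
  case (Cons b bs)
  let ?x = "word_tape (p @ (b # bs) @ z)"
  have x: "?x (int (length p)) = symbol b" by (simp add: word_tape_append)
  have "reach (Suc (length bs))
     (3, [(?x, int (length p)), (ones n, int (length (b # bs)) - 1), (v, c),
       (word_tape w, int (length w))])
     (3, [(?x, int (length (p @ b # bs))), (ones n, -1), (v, c),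
       (word_tape (w @ b # bs), int (length (w @ b # bs)))])"
  proof (rule reach_step)
    show "step cone_tm (3, [(?x, int (length p)), (ones n, int (length (b # bs)) - 1), (v, c),
       (word_tape w, int (length w))]) =
      (3, [(?x, int (length (p @ [b]))), (ones n, int (length bs) - 1), (v, c),
       (word_tape (w @ [b]), int (length (w @ [b])))])"
      using x Cons.prems by (simp add: cone_step ones_eq word_tape_snoc[symmetric])
    show "reach (length bs) (3, [(?x, int (length (p @ [b]))), (ones n, int (length bs) - 1), (v, c),
       (word_tape (w @ [b]), int (length (w @ [b])))])
      (3, [(?x, int (length (p @ b # bs))), (ones n, -1), (v, c),
       (word_tape (w @ b # bs), int (length (w @ b # bs)))])"
      using Cons.IH[of "p @ [b]" "w @ [b]"] Cons.prems by simp
  qed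
  then show ?case by simp
qed

lemma rewind_row:
  assumes "i \<le> n"
  shows "reach (Suc i) (4, [(x, a), (ones n, int n - int i), (v, c), (y, d)])
     (2, [(x, a), (ones n, int n - 1), (v, c), (y, d)])"
  using assms
proof (induction i)
  case 0
  show ?case by (rule reach_step[OF _ reach_refl]) (simp add: cone_step ones_eq)
next
  case (Suc i)
  show ?case
    by (rule reach_step[OF _ Suc.IH]) (use Suc.prems in \<open>simp_all add: cone_step ones_eq\<close>)
qed

text \<open>A row takes \<open>2 * n + 3\<close> steps: one to move the row counter,
  \<open>n\<close> to copy, one to append the apex entry and \<open>n + 1\<close> to rewind. The
  extra step at the end finds the blank at cell -1 of tape 2.\<close>

lemma copy_rows:
  assumes "\<forall>r\<in>set rs. length r = n" "length rs \<le> n"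
  shows "reach (length rs * (2 * n + 3) + 1)
     (2, [(word_tape (p @ concat rs @ z), int (length p)), (ones n, int n - 1),
       (ones n, int (length rs) - 1), (word_tape w, int (length w))])
     (5, [(word_tape (p @ concat rs @ z), int (length (p @ concat rs))), (ones n, int n - 1),
       (ones n, -1), (word_tape (w @ concat (map (\<lambda>r. r @ [True]) rs)),
        int (length (w @ concat (map (\<lambda>r. r @ [True]) rs))))])"
  using assms
proof (induction rs arbitrary: p w)
  case Nil
  show ?case
    by (simp, rule reach_step[OF _ reach_refl]) (simp add: cone_step ones_eq)
next
  case (Cons r rs)
  let ?x = "word_tape (p @ concat (r # rs) @ z)" and ?v = "(ones n, int (length rs) - 1)"
  let ?w = "w @ r @ [True]"
  have r: "length r = n" using Cons.prems by simp
  have 1: "reach (Suc (Suc n + Suc n))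
     (2, [(?x, int (length p)), (ones n, int n - 1), (ones n, int (length (r # rs)) - 1),
       (word_tape w, int (length w))])
     (2, [(?x, int (length (p @ r))), (ones n, int n - 1), ?v, (word_tape ?w, int (length ?w))])"
  proof (rule reach_step)
    show "step cone_tm (2, [(?x, int (length p)), (ones n, int n - 1),
       (ones n, int (length (r # rs)) - 1), (word_tape w, int (length w))]) =
      (3, [(?x, int (length p)), (ones n, int n - 1), ?v, (word_tape w, int (length w))])"
      using Cons.prems by (simp add: cone_step ones_eq)
    show "reach (Suc n + Suc n)
      (3, [(?x, int (length p)), (ones n, int n - 1), ?v, (word_tape w, int (length w))])
      (2, [(?x, int (length (p @ r))), (ones n, int n - 1), ?v, (word_tape ?w, int (length ?w))])"
    proof (rule reach_trans)
      show "reach n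
        (3, [(?x, int (length p)), (ones n, int n - 1), ?v, (word_tape w, int (length w))])
        (3, [(?x, int (length (p @ r))), (ones n, -1), ?v, (word_tape (w @ r), int (length (w @ r)))])"
        using copy_row[of r n p "concat rs @ z"] r by simp
      show "reach (Suc (Suc n))
        (3, [(?x, int (length (p @ r))), (ones n, -1), ?v, (word_tape (w @ r), int (length (w @ r)))])
        (2, [(?x, int (length (p @ r))), (ones n, int n - 1), ?v, (word_tape ?w, int (length ?w))])"
      proof (rule reach_step)
        show "step cone_tm
          (3, [(?x, int (length (p @ r))), (ones n, -1), ?v, (word_tape (w @ r), int (length (w @ r)))]) =
          (4, [(?x, int (length (p @ r))), (ones n, 0), ?v, (word_tape ?w, int (length ?w))])"
          using word_tape_snoc[of "w @ r" True] by (simp add: cone_step ones_eq)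
        show "reach (Suc n)
          (4, [(?x, int (length (p @ r))), (ones n, 0), ?v, (word_tape ?w, int (length ?w))])
          (2, [(?x, int (length (p @ r))), (ones n, int n - 1), ?v, (word_tape ?w, int (length ?w))])"
          using rewind_row[of n n] by simp
      qed
    qed simp
  qed
  have 2: "reach (length rs * (2 * n + 3) + 1)
     (2, [(?x, int (length (p @ r))), (ones n, int n - 1), ?v, (word_tape ?w, int (length ?w))])
     (5, [(?x, int (length (p @ r @ concat rs))), (ones n, int n - 1),
       (ones n, -1), (word_tape (?w @ concat (map (\<lambda>r. r @ [True]) rs)),
        int (length (?w @ concat (map (\<lambda>r. r @ [True]) rs))))])"
    using Cons.IH[of "p @ r" ?w] Cons.prems by simp
  show ?case
    using reach_trans[OF 1 2, of "length (r # rs) * (2 * n + 3) + 1"] by simp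
qed

text \<open>The row of the apex consists of ones up to its zero on the diagonal. The head of tape 1
  ends at cell 0, where the increments expect it.\<close>

lemma write_last_row:
  assumes "i \<le> n"
  shows "reach (Suc i) (5, [(x, a), (ones n, int i - 1), (v, c), (word_tape w, int (length w))])
     (6, [(x, a), (ones n, 0), (v, c),
       (word_tape (w @ replicate i True @ [False]), int (length (w @ replicate i True @ [False])))])"
  using assms
proof (induction i arbitrary: w)
  case 0
  show ?case
    by (rule reach_step[OF _ reach_refl])
      (simp add: cone_step ones_eq word_tape_snoc_False del: One_nat_def)
next
  case (Suc i)
  show ?case
  proof (rule reach_step)
    show "step cone_tm (5, [(x, a), (ones n, int (Suc i) - 1), (v, c), (word_tape w, int (length w))]) =
      (5, [(x, a), (ones n, int i - 1), (v, c), (word_tape (w @ [True]), int (length (w @ [True])))])"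
      using Suc.prems by (simp add: cone_step ones_eq word_tape_snoc_True)
    show "reach (Suc i)
      (5, [(x, a), (ones n, int i - 1), (v, c), (word_tape (w @ [True]), int (length (w @ [True])))])
      (6, [(x, a), (ones n, 0), (v, c), (word_tape (w @ replicate (Suc i) True @ [False]),
        int (length (w @ replicate (Suc i) True @ [False])))])"
      using Suc.IH[of "w @ [True]"] Suc.prems by simp
  qed
qed

section \<open>Copying and incrementing the threshold\<close>

lemma copy_negative:
  "reach (Suc (length bs))
     (7, [(word_tape (p @ bs), int (length p)), (u, b), (v, c), (word_tape w, int (length w))])
     (13, [(word_tape (p @ bs), int (length (p @ bs))), (u, b), (v, c),
       (word_tape (w @ bs), int (length (w @ bs)))])"
proof (induction bs arbitrary: p w)
  case Nil
  show ?case by (rule reach_step[OF _ reach_refl]) (simp add: cone_step word_tape_end)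
next
  case (Cons e bs)
  let ?x = "word_tape (p @ e # bs)"
  show ?case
  proof (rule reach_step)
    show "step cone_tm (7, [(?x, int (length p)), (u, b), (v, c), (word_tape w, int (length w))]) =
      (7, [(?x, int (length (p @ [e]))), (u, b), (v, c), (word_tape (w @ [e]), int (length (w @ [e])))])"
      by (simp add: cone_step word_tape_append word_tape_snoc[symmetric])
    show "reach (length (e # bs))
      (7, [(?x, int (length (p @ [e]))), (u, b), (v, c), (word_tape (w @ [e]), int (length (w @ [e])))])
      (13, [(?x, int (length (p @ e # bs))), (u, b), (v, c),
        (word_tape (w @ e # bs), int (length (w @ e # bs)))])"
      using Cons.IH[of "p @ [e]" "w @ [e]"] by simp
  qed
qed

lemma word_tape_update:
  "(word_tape (w @ b # z))(int (length w) := symbol b') = word_tape (w @ b' # z)"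
  by (rule ext) (auto simp: word_tape_def nth_append nth_Cons')

text \<open>The symbol 3 occurs on no word tape, so a head moving left can recognise cell
  \<open>s\<close>, the place of the sign bit.\<close>

definition marked :: "nat \<Rightarrow> bool list \<Rightarrow> int \<Rightarrow> nat" where
  "marked s w = (word_tape w)(int s := 3)"

lemma marked_same: "marked s w (int s) = 3"
  by (simp add: marked_def)

lemma marked_other: "s \<noteq> i \<Longrightarrow> marked s w (int i) = word_tape w (int i)"
  by (simp add: marked_def)

lemma marked_end: "s < length w \<Longrightarrow> marked s w (int (length w)) = 0"
  by (simp add: marked_other word_tape_end)

lemma marked_append: "s < length w \<Longrightarrow> marked s (w @ b # z) (int (length w)) = symbol b"
  by (simp add: marked_other word_tape_append)

lemma marked_snoc:
  "s < length w \<Longrightarrow> (marked s w)(int (length w) := symbol b) = marked s (w @ [b])"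
  unfolding marked_def word_tape_snoc[symmetric] by (rule fun_upd_twist) simp

lemma marked_update:
  "s < length w \<Longrightarrow> (marked s (w @ b # z))(int (length w) := symbol b') = marked s (w @ b' # z)"
  unfolding marked_def word_tape_update[of w b z b', symmetric] by (rule fun_upd_twist) simp

lemmas marked_snoc_True = marked_snoc[where b = True, unfolded if_True]
  and marked_update_True = marked_update[where b' = True, unfolded if_True]
  and marked_update_False = marked_update[where b' = False, unfolded if_False]

lemma copy_nonnegative:
  assumes "s < length w"
  shows "reach (Suc (length bs))
     (8, [(word_tape (p @ bs), int (length p)), (u, b), (v, c),
       (marked s w, int (length w))])
     (9, [(word_tape (p @ bs), int (length (p @ bs))), (u, b), (v, c),
       (marked s (w @ bs), int (length (w @ bs)) - 1)])"
  using assms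
proof (induction bs arbitrary: p w)
  case Nil
  show ?case by (rule reach_step[OF _ reach_refl]) (simp add: cone_step word_tape_end)
next
  case (Cons e bs)
  let ?x = "word_tape (p @ e # bs)"
  show ?case
  proof (rule reach_step)
    show "step cone_tm (8, [(?x, int (length p)), (u, b), (v, c),
         (marked s w, int (length w))]) =
      (8, [(?x, int (length (p @ [e]))), (u, b), (v, c),
         (marked s (w @ [e]), int (length (w @ [e])))])"
      using Cons.prems
      by (simp add: cone_step word_tape_append marked_snoc[symmetric])
    show "reach (length (e # bs))
      (8, [(?x, int (length (p @ [e]))), (u, b), (v, c),
         (marked s (w @ [e]), int (length (w @ [e])))])
      (9, [(?x, int (length (p @ e # bs))), (u, b), (v, c),
        (marked s (w @ e # bs), int (length (w @ e # bs)) - 1)])"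
      using Cons.IH[of "w @ [e]" "p @ [e]"] Cons.prems by simp
  qed
qed

lemma return_to_marker:
  "reach i (9, [(x, a), (u, b), (v, c), (marked s w, int (s + i))])
     (9, [(x, a), (u, b), (v, c), (marked s w, int s)])"
proof (induction i)
  case 0
  show ?case by (simp add: reach_refl)
next
  case (Suc i)
  have "marked s w (int (s + Suc i)) \<noteq> 3"
    by (subst marked_other) (simp_all add: word_tape_def)
  then show ?case
    by (intro reach_step[OF _ Suc.IH]) (simp add: cone_step)
qed

text \<open>The least significant bit comes first, as in \<open>nat_bits\<close>, so the carry
  travels right and may extend the number into the blank part of the tape.\<close>

fun inc :: "bool list \<Rightarrow> bool list" where
  "inc [] = [True]"
| "inc (False # bs) = True # bs"
| "inc (True # bs) = False # inc bs"

lemma length_inc: "length (inc bs) \<le> Suc (length bs)"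
  by (induction bs rule: inc.induct) auto

lemma inc_nat_bits: "inc (nat_bits m) = nat_bits (Suc m)"
proof (induction m rule: nat_bits.induct)
  case (1 m)
  show ?case
  proof (cases "even m")
    case True
    then show ?thesis
      by (cases "m = 0") (simp_all add: nat_bits.simps[of m] nat_bits.simps[of "Suc m"] nat_bits.simps[of 0]
        nat_bits.simps[of "Suc 0"])
  next
    case False
    then have "m \<noteq> 0" "Suc m div 2 = Suc (m div 2)" by (auto elim: oddE)
    with False 1 show ?thesis
      by (simp add: nat_bits.simps[of m] nat_bits.simps[of "Suc m"])
  qed
qed

text \<open>Here \<open>i\<close> counts the digits after the marker that the carry has passed. The
  head ends one cell left of the last digit written, which depends on the carry, so only a range for
  \<open>h\<close> is stated.\<close>

lemma carry:
  assumes "length w = Suc (s + i)"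
  shows "\<exists>h. s \<le> h \<and> h \<le> s + i + length bs \<and> reach (Suc (length bs))
     (10, [(x, a), (u, b), (v, c), (marked s (w @ bs), int (length w))])
     (9, [(x, a), (u, b), (v, c), (marked s (w @ inc bs), int h)])"
  using assms
proof (induction bs arbitrary: w i rule: inc.induct)
  case 1
  then have "marked s w (int (length w)) = 0" by (intro marked_end) simp
  then have "step cone_tm (10, [(x, a), (u, b), (v, c), (marked s w, int (length w))]) =
      (9, [(x, a), (u, b), (v, c), (marked s (w @ [True]), int (s + i))])"
    using 1 marked_snoc_True[of s w] by (simp add: cone_step)
  from reach_step[OF this reach_refl] show ?case by (intro exI[of _ "s + i"]) simp
next
  case (2 bs)
  then have "marked s (w @ False # bs) (int (length w)) = 1" by (subst marked_append) simp_all
  then have "step cone_tm (10, [(x, a), (u, b), (v, c), (marked s (w @ False # bs), int (length w))]) =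
      (9, [(x, a), (u, b), (v, c), (marked s (w @ True # bs), int (s + i))])"
    using 2 marked_update_True[of s w False bs] by (simp add: cone_step)
  from reach_step[OF this reach_refl] show ?case by (intro exI[of _ "s + i"]) simp
next
  case (3 bs)
  then have "marked s (w @ True # bs) (int (length w)) = 2" by (subst marked_append) simp_all
  then have 1: "step cone_tm (10, [(x, a), (u, b), (v, c), (marked s (w @ True # bs), int (length w))]) =
      (10, [(x, a), (u, b), (v, c), (marked s ((w @ [False]) @ bs), int (length (w @ [False])))])"
    using 3 marked_update_False[of s w True bs] by (simp add: cone_step)
  obtain h where h: "s \<le> h" "h \<le> s + Suc i + length bs" "reach (Suc (length bs))
     (10, [(x, a), (u, b), (v, c), (marked s ((w @ [False]) @ bs), int (length (w @ [False])))])
     (9, [(x, a), (u, b), (v, c), (marked s ((w @ [False]) @ inc bs), int h)])"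
    using "3.IH"[of "w @ [False]" "Suc i"] "3.prems" by auto
  from reach_step[OF 1 h(3)] h(1,2) show ?case by (intro exI[of _ h]) simp
qed

text \<open>One step leaves the marker and advances tape 1, the carry takes at most
  \<open>length bs + 1\<close> steps, and the return to the marker at most
  \<open>length bs\<close>.\<close>

lemma increment:
  assumes s: "s = length w" and i: "i < m"
  shows "reach (2 * length bs + 2)
     (9, [(x, a), (ones m, int i), (v, c), (marked s (w @ False # bs), int s)])
     (9, [(x, a), (ones m, int (Suc i)), (v, c), (marked s (w @ False # inc bs), int s)])"
proof -
  let ?u = "(ones m, int (Suc i))"
  obtain h where h: "s \<le> h" "h \<le> s + length bs" "reach (Suc (length bs))
     (10, [(x, a), ?u, (v, c), (marked s (w @ False # bs), int (Suc s))])
     (9, [(x, a), ?u, (v, c), (marked s (w @ False # inc bs), int h)])"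
    using carry[of "w @ [False]" s 0 bs x a "ones m" "int (Suc i)" v c] s by auto
  have "reach (h - s)
     (9, [(x, a), ?u, (v, c), (marked s (w @ False # inc bs), int h)])
     (9, [(x, a), ?u, (v, c), (marked s (w @ False # inc bs), int s)])"
    using return_to_marker[of "h - s" x a "ones m" "int (Suc i)" v c s] h(1) by simp
  note reach_trans[OF h(3) this, of "2 * length bs + 1"]
  moreover have "step cone_tm
     (9, [(x, a), (ones m, int i), (v, c), (marked s (w @ False # bs), int s)]) =
     (10, [(x, a), ?u, (v, c), (marked s (w @ False # bs), int (Suc s))])"
    using i by (simp add: cone_step ones_eq marked_same)
  ultimately show ?thesis
    using h(2) reach_step by fastforce
qed

text \<open>An increment adds at most one bit, so \<open>B\<close> bounds the length of the number
  throughout.\<close>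

lemma increments:
  assumes s: "s = length w" and B: "length (nat_bits k) + l \<le> B" and "i + l \<le> m"
  shows "reach (l * (2 * B + 2))
     (9, [(x, a), (ones m, int i), (v, c), (marked s (w @ False # nat_bits k), int s)])
     (9, [(x, a), (ones m, int (i + l)), (v, c), (marked s (w @ False # nat_bits (k + l)), int s)])"
  using B assms(3)
proof (induction l arbitrary: i k)
  case 0
  show ?case by (simp add: reach_refl)
next
  case (Suc l)
  have "reach (2 * length (nat_bits k) + 2)
     (9, [(x, a), (ones m, int i), (v, c), (marked s (w @ False # nat_bits k), int s)])
     (9, [(x, a), (ones m, int (Suc i)), (v, c), (marked s (w @ False # inc (nat_bits k)), int s)])"
    by (rule increment[OF s]) (use Suc.prems in simp)
  from reach_trans[OF this reach_refl[of 0], of "2 * B + 2"] have 1: "reach (2 * B + 2)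
     (9, [(x, a), (ones m, int i), (v, c), (marked s (w @ False # nat_bits k), int s)])
     (9, [(x, a), (ones m, int (Suc i)), (v, c), (marked s (w @ False # nat_bits (Suc k)), int s)])"
    using Suc.prems by (simp add: inc_nat_bits)
  have "length (nat_bits (Suc k)) + l \<le> B"
    using Suc.prems length_inc[of "nat_bits k"] by (simp add: inc_nat_bits)
  moreover have "Suc i + l \<le> m" using Suc.prems by simp
  ultimately show ?case
    using reach_trans[OF 1 Suc.IH, of "Suc l * (2 * B + 2)"] by simp
qed

lemma rewind_counter:
  assumes "i \<le> m"
  shows "reach (Suc i) (12, [(x, a), (ones m, int i - 1), (v, c), (y, d)])
     (9, [(x, a), (ones m, 0), (v, c), (y, d)])"
  using assms
proof (induction i)
  case 0
  show ?case by (rule reach_step[OF _ reach_refl]) (simp add: cone_step ones_eq)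
next
  case (Suc i)
  show ?case
    by (rule reach_step[OF _ Suc.IH]) (use Suc.prems in \<open>simp_all add: cone_step ones_eq\<close>)
qed

text \<open>A sweep over \<open>m\<close> counter cells makes \<open>m\<close> increments; then one
  cell is erased and the induction takes over. The time bound pays for \<open>m + 1\<close> sweeps
  at the price of the longest. Only the output tape matters at the end, so the others are left
  existential.\<close>

lemma triangular_increments:
  assumes s: "s = length w" and B: "length (nat_bits k) + \<Sum>{1..m} \<le> B"
  shows "\<exists>ts. reach (Suc m * (m * (2 * B + 2) + m + 3))
     (9, [(x, a), (ones m, 0), (v, c), (marked s (w @ False # nat_bits k), int s)])
     (13, ts @ [(word_tape (w @ False # nat_bits (k + \<Sum>{1..m})), int s)])"
  using B
proof (induction m arbitrary: k)
  case 0
  \<comment> \<open>The last step, taken when tape 1 is empty, writes 1 over the marker and so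
    restores the sign bit \<open>False\<close>.\<close>
  have "(marked s (w @ False # nat_bits k))(int s := 1) = word_tape (w @ False # nat_bits k)"
    using word_tape_update[of w False "nat_bits k" False] s by (simp add: marked_def)
  then have "step cone_tm (11, [(x, a), (ones 0, -1), (v, c), (marked s (w @ False # nat_bits k), int s)]) =
      (13, [(x, a), (ones 0, -1), (v, c)] @ [(word_tape (w @ False # nat_bits k), int s)])"
    by (simp add: cone_step ones_eq del: One_nat_def replicate.simps)
  from reach_step[OF this reach_refl[of 1]]
  have "reach (Suc 2) (9, [(x, a), (ones 0, 0), (v, c), (marked s (w @ False # nat_bits k), int s)])
      (13, [(x, a), (ones 0, -1), (v, c)] @ [(word_tape (w @ False # nat_bits k), int s)])"
    by (intro reach_step[of "(9, _)"]) (simp_all add: cone_step ones_eq marked_same numeral_2_eq_2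
        del: replicate.simps)
  then show ?case by (intro exI[of _ "[(x, a), (ones 0, -1), (v, c)]"]) (simp add: numeral_3_eq_3
        numeral_2_eq_2 del: replicate.simps)
next
  case (Suc m)
  let ?k = "k + Suc m" and ?M = "Suc m"
  let ?y = "(marked s (w @ False # nat_bits ?k), int s)"
  have "length (nat_bits (k + l)) \<le> length (nat_bits k) + l" for l
  proof (induction l)
    case (Suc l)
    then show ?case using length_inc[of "nat_bits (k + l)"] by (simp add: inc_nat_bits)
  qed simp
  from this[of ?M] have B': "length (nat_bits ?k) + \<Sum>{1..m} \<le> B"
    using Suc.prems by simp
  obtain ts where IH: "reach (Suc m * (m * (2 * B + 2) + m + 3))
     (9, [(x, a), (ones m, 0), (v, c), ?y])
     (13, ts @ [(word_tape (w @ False # nat_bits (?k + \<Sum>{1..m})), int s)])"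
    using Suc.IH[OF B'] by blast
  have 1: "reach (?M * (2 * B + 2))
     (9, [(x, a), (ones ?M, 0), (v, c), (marked s (w @ False # nat_bits k), int s)])
     (9, [(x, a), (ones ?M, int ?M), (v, c), ?y])"
    using increments[OF s, of k ?M B 0 ?M] Suc.prems by simp
  \<comment> \<open>One step sees that the sweep is over, one erases the last counter cell, and
    \<open>m + 1\<close> rewind the shortened counter.\<close>
  have 2: "reach (Suc (Suc (Suc m))) (9, [(x, a), (ones ?M, int ?M), (v, c), ?y])
     (9, [(x, a), (ones m, 0), (v, c), ?y])"
  proof (rule reach_step)
    show "step cone_tm (9, [(x, a), (ones ?M, int ?M), (v, c), ?y]) =
      (11, [(x, a), (ones ?M, int m), (v, c), ?y])"
      by (simp add: cone_step ones_eq marked_same del: replicate.simps)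
    show "reach (Suc (Suc m)) (11, [(x, a), (ones ?M, int m), (v, c), ?y])
      (9, [(x, a), (ones m, 0), (v, c), ?y])"
    proof (rule reach_step)
      show "step cone_tm (11, [(x, a), (ones ?M, int m), (v, c), ?y]) =
        (12, [(x, a), (ones m, int m - 1), (v, c), ?y])"
        by (simp add: cone_step ones_eq ones_erase del: replicate.simps)
      show "reach (Suc m) (12, [(x, a), (ones m, int m - 1), (v, c), ?y])
        (9, [(x, a), (ones m, 0), (v, c), ?y])"
        by (rule rewind_counter) simp
    qed
  qed
  have "?M * (2 * B + 2) + Suc (Suc (Suc m)) + Suc m * (m * (2 * B + 2) + m + 3) \<le>
      Suc ?M * (?M * (2 * B + 2) + ?M + 3)"
    by (simp add: algebra_simps)
  note reach_trans[OF reach_trans[OF 1 2 order.refl] IH this]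
  moreover have "?k + \<Sum>{1..m} = k + \<Sum>{1..Suc m}" by simp
  ultimately show ?case by (intro exI[of _ ts]) (simp only:)
qed

section \<open>The encoding of the cone and the total running time\<close>

lemma adjacency_bits_cone:
  assumes "simple_graph {..<n} E"
  shows "adjacency_bits (Suc n) (cone n E) =
    concat (map (\<lambda>r. r @ [True]) (map (\<lambda>i. map (\<lambda>j. {i, j} \<in> E) [0..<n]) [0..<n])) @
    replicate n True @ [False]"
proof -
  have E: "e \<subseteq> {..<n}" "card e = 2" if "e \<in> E" for e
    using assms that by (auto simp: simple_graph_def)
  have inner: "{i, j} \<in> cone n E \<longleftrightarrow> {i, j} \<in> E" if "i < n" "j < n" for i j
    using that by (auto simp: cone_def doubleton_eq_iff)
  have apex: "{i, n} \<in> cone n E" if "i < n" for i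
    using that by (auto simp: cone_def)
  \<comment> \<open>The set \<open>{n, n}\<close> is the singleton \<open>{n}\<close>; edges of
    \<open>E\<close> lie below \<open>n\<close>, and every apex edge also contains some
    \<open>v < n\<close>.\<close>
  have diag: "{n, n} \<notin> cone n E"
    using E[of "{n}"] by (auto simp: cone_def)
  have row: "map (\<lambda>j. {i, j} \<in> cone n E) [0..<Suc n] = map (\<lambda>j. {i, j} \<in> E) [0..<n] @ [True]"
    if "i < n" for i
    using that by (simp add: inner apex)
  have "map (\<lambda>j. {n, j} \<in> cone n E) [0..<n] = replicate n True"
    using apex by (intro nth_equalityI) (auto simp: insert_commute)
  then have last: "map (\<lambda>j. {n, j} \<in> cone n E) [0..<Suc n] = replicate n True @ [False]"
    using diag by simp
  have rows: "map (\<lambda>i. map (\<lambda>j. {i, j} \<in> cone n E) [0..<Suc n]) [0..<n] =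
      map (\<lambda>r. r @ [True]) (map (\<lambda>i. map (\<lambda>j. {i, j} \<in> E) [0..<n]) [0..<n])"
    unfolding map_map by (rule map_cong[OF refl]) (use row in \<open>auto simp del: upt_Suc\<close>)
  have "[0..<Suc n] = [0..<n] @ [n]" by simp
  then have "adjacency_bits (Suc n) (cone n E) =
      concat (map (\<lambda>i. map (\<lambda>j. {i, j} \<in> cone n E) [0..<Suc n]) [0..<n]) @
      map (\<lambda>j. {n, j} \<in> cone n E) [0..<Suc n]"
    unfolding adjacency_bits_def by (simp del: upt_Suc)
  then show ?thesis unfolding rows last .
qed

text \<open>The phases take \<open>n\<close>, 2, \<open>n * (2 * n + 3) + 1\<close> and
  \<open>n + 1\<close> steps, and the bound is rounded up by one. The bits \<open>ib\<close> of the
  threshold are still unread.\<close>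

lemma run_adjacency:
  assumes "simple_graph {..<n} E"
  defines "w \<equiv> replicate (Suc n) True @ False # adjacency_bits (Suc n) (cone n E)"
    and "p \<equiv> replicate n True @ False # adjacency_bits n E"
  shows "reach (2 * n * n + 5 * n + 5) (start_config cone_tm (p @ ib))
     (6, [(word_tape (p @ ib), int (length p)), (ones n, 0), (ones n, -1), (word_tape w, int (length w))])"
proof -
  let ?x = "word_tape (p @ ib)" and ?p = "replicate n True @ [False]"
  define rs where "rs = map (\<lambda>i. map (\<lambda>j. {i, j} \<in> E) [0..<n]) [0..<n]"
  let ?w = "replicate (Suc n) True @ [False]"
  have p: "p = ?p @ concat rs" by (simp add: p_def rs_def adjacency_bits_def)
  have w: "w = (?w @ concat (map (\<lambda>r. r @ [True]) rs)) @ replicate n True @ [False]"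
    using adjacency_bits_cone[OF assms(1)] by (simp add: w_def rs_def)
  have "(\<lambda>_. 0) = ones 0" by (rule ext) (simp add: word_tape_def)
  then have start: "start_config cone_tm (p @ ib) = (0, [(?x, 0), (ones 0, 0), (ones 0, 0), (ones 0, 0)])"
    by (simp add: start_config_def cone_tm_def numeral_3_eq_3)
  have 1: "reach n (start_config cone_tm (p @ ib))
     (0, [(?x, int n), (ones n, int n), (ones n, int n), (ones n, int n)])"
    using read_unary[of n 0 "False # adjacency_bits n E @ ib"]
    unfolding start by (simp add: p_def)
  have "?x (int n) = 1"
    using word_tape_append[of "replicate n True" False "adjacency_bits n E @ ib"] by (simp add: p_def)
  then have 2: "step cone_tm (0, [(?x, int n), (ones n, int n), (ones n, int n), (ones n, int n)]) =
      (1, [(?x, int (length ?p)), (ones n, int n - 1), (ones n, int n - 1), (ones (Suc n), int (Suc n))])"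
    by (simp add: cone_step ones_snoc del: replicate.simps)
  have 3: "step cone_tm
      (1, [(?x, int (length ?p)), (ones n, int n - 1), (ones n, int n - 1), (ones (Suc n), int (Suc n))]) =
      (2, [(?x, int (length ?p)), (ones n, int n - 1), (ones n, int n - 1), (word_tape ?w, int (length ?w))])"
    using word_tape_snoc_False[of "replicate (Suc n) True"]
    by (simp add: cone_step del: One_nat_def replicate.simps)
  have 4: "reach (n * (2 * n + 3) + 1)
      (2, [(?x, int (length ?p)), (ones n, int n - 1), (ones n, int n - 1), (word_tape ?w, int (length ?w))])
      (5, [(?x, int (length p)), (ones n, int n - 1), (ones n, -1),
        (word_tape (?w @ concat (map (\<lambda>r. r @ [True]) rs)),
         int (length (?w @ concat (map (\<lambda>r. r @ [True]) rs))))])"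
    using copy_rows[of rs n ?p ib ?w] unfolding p append_assoc by (simp add: rs_def)
  have 5: "reach (Suc n)
      (5, [(?x, int (length p)), (ones n, int n - 1), (ones n, -1),
        (word_tape (?w @ concat (map (\<lambda>r. r @ [True]) rs)),
         int (length (?w @ concat (map (\<lambda>r. r @ [True]) rs))))])
      (6, [(?x, int (length p)), (ones n, 0), (ones n, -1), (word_tape w, int (length w))])"
    unfolding w by (rule write_last_row) simp
  show ?thesis
    by (rule reach_trans[OF 1 reach_step[OF 2 reach_step[OF 3 reach_trans[OF 4 5 order.refl]]]])
      (simp add: algebra_simps)
qed

lemma sum_upto_le_square: "\<Sum>{1..n} \<le> n * (n :: nat)"
proof (induction n)
  case (Suc n)
  then show ?case by simp
qed simp

text \<open>The matrix makes \<open>n * n\<close>, and with it \<open>1 + ... + n\<close>, at most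
  the input length \<open>?L\<close>, so adding by counting is affordable. The increments dominate:
  about \<open>n\<close> sweeps of at most \<open>n\<close> increments, each linear in
  \<open>B\<close>, are cubic in \<open>?L\<close>.\<close>

lemma cone_tm_computes:
  assumes "x \<in> instances"
  shows "computes_within cone_tm (encode x) (encode (reduction x)) (20 * (1 + length (encode x)) ^ 3)"
proof -
  obtain n E k where x: "x = (n, E, k)" by (metis prod_cases3)
  with assms have G: "simple_graph {..<n} E" by (simp add: instances_def)
  define w where "w = replicate (Suc n) True @ False # adjacency_bits (Suc n) (cone n E)"
  define p where "p = replicate n True @ False # adjacency_bits n E"
  define bs where "bs = nat_bits (nat \<bar>k\<bar>)"
  let ?L = "length (encode x)" and ?x = "word_tape (encode x)" and ?s = "length w"
  have enc: "encode x = p @ (k < 0) # bs"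
    by (simp add: x encode_def int_bits_def p_def bs_def)
  have L: "?L = n * n + n + length bs + 2"
    by (simp add: enc p_def length_adjacency_bits)
  have nn: "n * n \<le> ?L" "n \<le> ?L" "length bs \<le> ?L" by (simp_all add: L)
  have 1: "reach (2 * n * n + 5 * n + 5) (start_config cone_tm (encode x))
     (6, [(?x, int (length p)), (ones n, 0), (ones n, -1), (word_tape w, int ?s)])"
    using run_adjacency[OF G, of "(k < 0) # bs"] by (simp add: enc p_def w_def)
  have sign: "?x (int (length p)) = symbol (k < 0)"
    unfolding enc by (rule word_tape_append)
  have "\<exists>ts h. reach (20 * (1 + ?L) ^ 3) (start_config cone_tm (encode x))
      (13, ts @ [(word_tape (encode (reduction x)), h)])"
  proof (cases "k < 0")
    case True
    have out: "encode (reduction x) = (w @ [True]) @ bs"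
      using True by (simp add: x reduction_def encode_def int_bits_def w_def bs_def)
    have 2: "step cone_tm (6, [(?x, int (length p)), (ones n, 0), (ones n, -1), (word_tape w, int ?s)]) =
      (7, [(?x, int (length (p @ [True]))), (ones n, 0), (ones n, -1),
        (word_tape (w @ [True]), int (length (w @ [True])))])"
      using True sign by (simp add: cone_step word_tape_snoc_True)
    have 3: "reach (Suc (length bs))
      (7, [(?x, int (length (p @ [True]))), (ones n, 0), (ones n, -1),
        (word_tape (w @ [True]), int (length (w @ [True])))])
      (13, [(?x, int (length ((p @ [True]) @ bs))), (ones n, 0), (ones n, -1)] @
        [(word_tape (encode (reduction x)), int (length ((w @ [True]) @ bs)))])"
      using copy_negative[of bs "p @ [True]" "ones n" 0 "ones n" "-1" "w @ [True]"] True by (simp add: enc out)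
    have "2 * n * n + 5 * n + 5 + Suc (Suc (length bs)) \<le> 20 * (1 + ?L) ^ 3"
      using nn by (simp add: power3_eq_cube algebra_simps)
    from reach_trans[OF 1 reach_step[OF 2 3] this] show ?thesis by blast
  next
    case False
    define S where "S = \<Sum>{1..n}"
    \<comment> \<open>A crude bound of one new bit per increment; it still gives
      \<open>B \<le> 2 * ?L\<close>.\<close>
    define B where "B = length bs + S"
    have "reduction x = (Suc n, cone n E, k + int S)"
      using False unfolding x reduction_def S_def by simp
    moreover have "int_bits (k + int S) = False # nat_bits (nat \<bar>k\<bar> + S)"
      using False by (simp add: int_bits_def nat_add_distrib)
    ultimately have out: "encode (reduction x) = w @ False # nat_bits (nat \<bar>k\<bar> + S)"
      by (simp add: encode_def w_def)
    \<comment> \<open>The marker goes where the sign bit \<open>False\<close> of the output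
      belongs.\<close>
    have "(word_tape w)(int ?s := 3) = marked ?s (w @ [False])"
      unfolding marked_def word_tape_snoc[symmetric] by simp
    then have 2: "step cone_tm (6, [(?x, int (length p)), (ones n, 0), (ones n, -1), (word_tape w, int ?s)]) =
      (8, [(?x, int (length (p @ [False]))), (ones n, 0), (ones n, -1),
        (marked ?s (w @ [False]), int (length (w @ [False])))])"
      using False sign by (simp add: cone_step)
    have 3: "reach (Suc (length bs))
      (8, [(?x, int (length (p @ [False]))), (ones n, 0), (ones n, -1),
        (marked ?s (w @ [False]), int (length (w @ [False])))])
      (9, [(?x, int (length ((p @ [False]) @ bs))), (ones n, 0), (ones n, -1),
        (marked ?s (w @ False # bs), int (?s + length bs))])"
      using copy_nonnegative[of ?s "w @ [False]" bs "p @ [False]" "ones n" 0 "ones n" "-1"]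
        False by (simp add: enc)
    have 4: "reach (length bs)
      (9, [(?x, int (length ((p @ [False]) @ bs))), (ones n, 0), (ones n, -1),
        (marked ?s (w @ False # bs), int (?s + length bs))])
      (9, [(?x, int (length ((p @ [False]) @ bs))), (ones n, 0), (ones n, -1),
        (marked ?s (w @ False # bs), int ?s)])"
      by (rule return_to_marker)
    obtain ts where 5: "reach (Suc n * (n * (2 * B + 2) + n + 3))
      (9, [(?x, int (length ((p @ [False]) @ bs))), (ones n, 0), (ones n, -1),
        (marked ?s (w @ False # bs), int ?s)])
      (13, ts @ [(word_tape (encode (reduction x)), int ?s)])"
      using triangular_increments[of ?s w "nat \<bar>k\<bar>" n B]
      unfolding out bs_def B_def S_def by blast
    have "B \<le> 2 * ?L" using sum_upto_le_square[of n] nn by (simp add: B_def S_def)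
    then have "Suc n * (n * (2 * B + 2) + n + 3) \<le> Suc ?L * (?L * (2 * (2 * ?L) + 2) + ?L + 3)"
      using nn by (intro mult_mono add_mono) auto
    then have "2 * n * n + 5 * n + 5 + Suc (Suc (length bs) + (length bs +
        Suc n * (n * (2 * B + 2) + n + 3))) \<le> 20 * (1 + ?L) ^ 3"
      using nn by (simp add: power3_eq_cube algebra_simps)
    from reach_trans[OF 1 reach_step[OF 2 reach_trans[OF 3 reach_trans[OF 4 5 order.refl] order.refl]] this]
    show ?thesis by blast
  qed
  then obtain ts h t where "t \<le> 20 * (1 + ?L) ^ 3"
    "(step cone_tm ^^ t) (start_config cone_tm (encode x)) =
      (13, ts @ [(word_tape (encode (reduction x)), h)])"
    unfolding reach_def by blast
  then show ?thesis
    unfolding computes_within_def by (intro exI[of _ t]) (simp add: cone_tm_def)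
qed

theorem theorem8:
  "\<exists>f. poly_time_computable instances encode encode f \<and>
       (\<forall>x\<in>instances. f x \<in> instances \<and> (x \<in> MLVC \<longleftrightarrow> f x \<in> Graphic_MLOP))"
proof (intro exI[of _ reduction] conjI ballI)
  \<comment> \<open>The time bound of \<open>cone_tm_computes\<close> as the value of a polynomial
    at the input length.\<close>
  have "poly (smult 20 ([:1, 1:] ^ 3)) l = 20 * (1 + l) ^ 3" for l :: nat
    by (simp add: poly_power)
  then show "poly_time_computable instances encode encode reduction"
    unfolding poly_time_computable_def
    using turing_machine_cone_tm cone_tm_computes by metis
qed (use reduction_correct in blast)+

end
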